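(* Let $n \geq 1$. The set of strongly doubly reversible pairs in $\mathrm{PSp}(n,1)$ has Haar measure zero in $\mathrm{PSp}(n,1)\times \mathrm{PSp}(n,1)$.
   Context: $\mathbb{H}$ denotes Hamilton's quaternions and $\mathbb{H}^{n+1}$ is regarded as a right $\mathbb{H}$-vector space with the Hermitian form $\langle \mathbf z,\mathbf w\rangle = \bar w_{n+1} z_1 + \sum_{i=2}^{n} \bar w_i z_i + \bar w_1 z_{n+1}$. $\mathrm{Sp}(n,1)$ is the group of $(n+1)\times(n+1)$ quaternionic matrices preserving this form, and $\mathrm{PSp}(n,1)=\mathrm{Sp}(n,1)/\{\pm I\}$ (the isometry group of quaternionic hyperbolic $n$-space). For a group $G$, a pair $(g_1,g_2)\in G\times G$ is strongly doubly reversible if there is $g\in G$ with $g^2=1$ such that $g g_1 g^{-1}=g_1^{-1}$ and $g g_2 g^{-1}=g_2^{-1}$; equivalently, there are involutions $i_1,i_2,i_3\in G$ with $g_1=i_1i_2$, $g_2=i_1i_3$. *)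

theory Defs
  imports "HOL-Analysis.Analysis" "HOL-Algebra.Group"
begin

text \<open>A quaternion a + b i + c j + d k is represented by the vector (a,b,c,d) in real^4,
  with components q$1 (real part), q$2 (i), q$3 (j), q$4 (k).  Addition, negation and
  zero are the vector ones (and the topology is the Euclidean one); multiplication and
  conjugation follow Hamilton's rules i^2 = j^2 = k^2 = ijk = -1.\<close>

type_synonym quat = "real^4"

definition mk_quat :: "real \<Rightarrow> real \<Rightarrow> real \<Rightarrow> real \<Rightarrow> quat" where
  "mk_quat a b c d = (\<chi> i. if i = 1 then a else if i = 2 then b else if i = 3 then c else d)"

definition qmul :: "quat \<Rightarrow> quat \<Rightarrow> quat" where
  "qmul p q = mk_quat
     (p$1 * q$1 - p$2 * q$2 - p$3 * q$3 - p$4 * q$4)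
     (p$1 * q$2 + p$2 * q$1 + p$3 * q$4 - p$4 * q$3)
     (p$1 * q$3 - p$2 * q$4 + p$3 * q$1 + p$4 * q$2)
     (p$1 * q$4 + p$2 * q$3 - p$3 * q$2 + p$4 * q$1)"

definition qconj :: "quat \<Rightarrow> quat" where
  "qconj p = mk_quat (p$1) (- p$2) (- p$3) (- p$4)"

definition qone :: quat where
  "qone = mk_quat 1 0 0 0"

text \<open>Vectors of H^(n+1) are functions nat => quat (only the entries 1..n+1 matter);
  matrices are functions nat => nat => quat, indexed by 1..n+1, required to vanish
  outside this range.  H^(n+1) is a right H-vector space and matrices act on the left.\<close>

type_synonym qvec = "nat \<Rightarrow> quat"
type_synonym qmat = "nat \<Rightarrow> nat \<Rightarrow> quat"

definition qmat_apply :: "nat \<Rightarrow> qmat \<Rightarrow> qvec \<Rightarrow> qvec" where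
  "qmat_apply n A z = (\<lambda>i. \<Sum>k\<in>{1..n+1}. qmul (A i k) (z k))"

definition qmat_mult :: "nat \<Rightarrow> qmat \<Rightarrow> qmat \<Rightarrow> qmat" where
  "qmat_mult n A B = (\<lambda>i j. if i \<in> {1..n+1} \<and> j \<in> {1..n+1}
                            then (\<Sum>k\<in>{1..n+1}. qmul (A i k) (B k j)) else 0)"

definition qmat_id :: "nat \<Rightarrow> qmat" where
  "qmat_id n = (\<lambda>i j. if i \<in> {1..n+1} \<and> i = j then qone else 0)"

definition hform :: "nat \<Rightarrow> qvec \<Rightarrow> qvec \<Rightarrow> quat" where
  "hform n z w = qmul (qconj (w (n+1))) (z 1)
                 + (\<Sum>i\<in>{2..n}. qmul (qconj (w i)) (z i))
                 + qmul (qconj (w 1)) (z (n+1))"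

definition Sp :: "nat \<Rightarrow> qmat set" where
  "Sp n = {A. (\<forall>i j. \<not> (i \<in> {1..n+1} \<and> j \<in> {1..n+1}) \<longrightarrow> A i j = 0)
             \<and> (\<forall>z w. hform n (qmat_apply n A z) (qmat_apply n A w) = hform n z w)}"

text \<open>Sp(n,1) carries the subspace topology of the space of matrices
  (product topology on nat => nat => real^4, i.e. Euclidean on the finitely many
  relevant entries).\<close>

definition Sp_top :: "nat \<Rightarrow> qmat topology" where
  "Sp_top n = subtopology euclidean (Sp n)"

definition pcls :: "qmat \<Rightarrow> qmat set" where
  "pcls A = {A, - A}"

definition PSp_carrier :: "nat \<Rightarrow> qmat set set" where
  "PSp_carrier n = pcls ` Sp n"

definition PSp :: "nat \<Rightarrow> qmat set monoid" where
  "PSp n = \<lparr> carrier = PSp_carrier n,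
             mult = (\<lambda>X Y. {qmat_mult n A B | A B. A \<in> X \<and> B \<in> Y}),
             one = pcls (qmat_id n) \<rparr>"

definition PSp_top :: "nat \<Rightarrow> qmat set topology" where
  "PSp_top n = topology (\<lambda>U. U \<subseteq> PSp_carrier n \<and>
                              openin (Sp_top n) {A \<in> Sp n. pcls A \<in> U})"

definition strongly_doubly_reversible :: "('a, 'b) monoid_scheme \<Rightarrow> 'a \<Rightarrow> 'a \<Rightarrow> bool" where
  "strongly_doubly_reversible G g1 g2 \<longleftrightarrow>
     (\<exists>g \<in> carrier G. g \<otimes>\<^bsub>G\<^esub> g = \<one>\<^bsub>G\<^esub>
        \<and> g \<otimes>\<^bsub>G\<^esub> g1 \<otimes>\<^bsub>G\<^esub> inv\<^bsub>G\<^esub> g = inv\<^bsub>G\<^esub> g1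
        \<and> g \<otimes>\<^bsub>G\<^esub> g2 \<otimes>\<^bsub>G\<^esub> inv\<^bsub>G\<^esub> g = inv\<^bsub>G\<^esub> g2)"

definition borel_of_top :: "'a topology \<Rightarrow> 'a measure" where
  "borel_of_top T = sigma (topspace T) {U. openin T U}"

definition is_haar_measure ::
    "'a topology \<Rightarrow> ('a \<Rightarrow> 'a \<Rightarrow> 'a) \<Rightarrow> 'a measure \<Rightarrow> bool" where
  "is_haar_measure T mul \<mu> \<longleftrightarrow>
     sets \<mu> = sets (borel_of_top T) \<and> space \<mu> = topspace T
     \<and> (\<forall>g \<in> topspace T. \<forall>A \<in> sets \<mu>. emeasure \<mu> (mul g ` A) = emeasure \<mu> A)
     \<and> (\<forall>K. compactin T K \<longrightarrow> emeasure \<mu> K < \<infinity>)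
     \<and> (\<forall>U. openin T U \<and> U \<noteq> {} \<longrightarrow> emeasure \<mu> U > 0)
     \<and> (\<forall>A \<in> sets \<mu>. emeasure \<mu> A = (INF U \<in> {U. openin T U \<and> A \<subseteq> U}. emeasure \<mu> U))
     \<and> (\<forall>U. openin T U \<longrightarrow>
            emeasure \<mu> U = (SUP K \<in> {K. compactin T K \<and> K \<subseteq> U}. emeasure \<mu> K))"

text \<open>S has Haar measure zero: S is contained in a Borel set of measure zero for
  every Haar measure (Haar measures are unique up to a positive scalar).\<close>

definition haar_null :: "'a topology \<Rightarrow> ('a \<Rightarrow> 'a \<Rightarrow> 'a) \<Rightarrow> 'a set \<Rightarrow> bool" where
  "haar_null T mul S \<longleftrightarrow>
     (\<forall>\<mu>. is_haar_measure T mul \<mu> \<longrightarrow> (\<exists>N \<in> sets \<mu>. S \<subseteq> N \<and> emeasure \<mu> N = 0))"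

definition PSp2_top :: "nat \<Rightarrow> (qmat set \<times> qmat set) topology" where
  "PSp2_top n = prod_topology (PSp_top n) (PSp_top n)"

definition PSp2_mult :: "nat \<Rightarrow> qmat set \<times> qmat set \<Rightarrow> qmat set \<times> qmat set \<Rightarrow> qmat set \<times> qmat set" where
  "PSp2_mult n p q = (fst p \<otimes>\<^bsub>PSp n\<^esub> fst q, snd p \<otimes>\<^bsub>PSp n\<^esub> snd q)"

end

theory Submission
  imports Defs "Jordan_Normal_Form.Determinant"
begin

text \<open>If an element conjugates the classes of a and b to their inverses, then
  Re tr (a a a b a b b b) = Re tr (b b b a b a a a), because Re tr is invariant under conjugation
  and, on Sp(n,1), under inversion; both words contain each letter an even number of times, so the
  sign ambiguity of the lifts disappears.  Hence the pairs in question lie in the zero set of a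
  polynomial, the reversal defect.

  Any pair (a, b) can be moved off this zero set by left multiplication with products of three
  transvections I + t v p <., v> (v isotropic, p imaginary): after rescaling, such products
  multiplied with a tend, as t grows, to arbitrary rank one matrices with isotropic image and
  coimage, and on a suitable pair of these the defect is -32.  So near every point there is a
  curve x(t) through the identity along which the defect of x(t)(a, b) is a nonzero polynomial of
  degree at most 24.  If E is the part of the zero set near that point, then infinitely many translates
  of E by elements x(t)^-1 lie in one set of finite measure and cover each point at most 24 times.
  Left invariance forces E to be null.\<close>

no_notation vec_index (infixl "$" 100)

section \<open>Quaternions and quaternionic matrices\<close>

lemma mk_quat_nth [simp]:
  "mk_quat a b c d $ 1 = a" "mk_quat a b c d $ 2 = b"
  "mk_quat a b c d $ 3 = c" "mk_quat a b c d $ 4 = d"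
  by (simp_all add: mk_quat_def)

lemma quat_eq_iff:
  "p = q \<longleftrightarrow> p$1 = q$1 \<and> p$2 = q$2 \<and> p$3 = q$3 \<and> p$4 = q$4" for p q :: quat
  by (simp add: Finite_Cartesian_Product.vec_eq_iff forall_4)

interpretation qmul: bounded_bilinear qmul
  unfolding bilinear_conv_bounded_bilinear [symmetric] bilinear_def
  by (auto intro!: linearI simp: quat_eq_iff qmul_def algebra_simps)

lemma linear_qconj: "linear qconj"
  by (auto intro!: linearI simp: quat_eq_iff qconj_def algebra_simps)

lemmas qconj_sum = linear_sum[OF linear_qconj]
  and qconj_add = linear_add[OF linear_qconj]
  and qconj_minus = linear_neg[OF linear_qconj]
  and qconj_zero [simp] = linear_0[OF linear_qconj]
  and qconj_scaleR = linear_scale[OF linear_qconj]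

lemma qmul_assoc: "qmul (qmul p q) r = qmul p (qmul q r)"
  by (simp add: quat_eq_iff qmul_def algebra_simps)

lemma qmul_qone [simp]: "qmul qone q = q" "qmul q qone = q"
  by (simp_all add: quat_eq_iff qmul_def qone_def)

lemma qconj_qmul: "qconj (qmul p q) = qmul (qconj q) (qconj p)"
  by (simp add: quat_eq_iff qmul_def qconj_def algebra_simps)

lemma qconj_qconj [simp]: "qconj (qconj q) = q"
  by (simp add: quat_eq_iff qconj_def)

lemma qconj_qone [simp]: "qconj qone = qone"
  by (simp add: quat_eq_iff qconj_def qone_def)

lemma qconj_nth_1 [simp]: "qconj q $ 1 = q $ 1"
  by (simp add: qconj_def)

lemma Re_qmul_commute: "qmul p q $ 1 = qmul q p $ 1"
  by (simp add: qmul_def)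

lemma qmul_qconj_self: "qmul q (qconj q) = (norm q)\<^sup>2 *\<^sub>R qone"
  by (simp add: quat_eq_iff qmul_def qconj_def qone_def power2_norm_eq_inner inner_vec_def sum_4 algebra_simps)

lemma qmul_qconj_self': "qmul (qconj q) q = (norm q)\<^sup>2 *\<^sub>R qone"
  by (simp add: quat_eq_iff qmul_def qconj_def qone_def power2_norm_eq_inner inner_vec_def sum_4 algebra_simps)

definition qinv :: "quat \<Rightarrow> quat" where
  "qinv q = (1 / (norm q)\<^sup>2) *\<^sub>R qconj q"

lemma qmul_qinv [simp]: "q \<noteq> 0 \<Longrightarrow> qmul q (qinv q) = qone" "q \<noteq> 0 \<Longrightarrow> qmul (qinv q) q = qone"
  by (simp_all add: qinv_def qmul.scaleR_right qmul.scaleR_left qmul_qconj_self qmul_qconj_self')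

lemma qmul_eq_0_iff [simp]: "qmul p q = 0 \<longleftrightarrow> p = 0 \<or> q = 0"
  by (metis qmul.zero_left qmul.zero_right qmul_assoc qmul_qinv(1) qmul_qone(2))

section \<open>The index set, the form as a sum, and matrix algebra with adjoints\<close>

definition ix :: "nat \<Rightarrow> nat set" where
  "ix n = {1..n+1}"

lemma finite_ix [simp]: "finite (ix n)"
  by (simp add: ix_def)

lemma one_mem_ix [simp]: "1 \<in> ix n" "Suc 0 \<in> ix n"
  and last_mem_ix [simp]: "n + 1 \<in> ix n" "Suc n \<in> ix n"
  by (simp_all add: ix_def)

text \<open>The Gram matrix of the form is the permutation matrix of this involution.\<close>

definition flip_ix :: "nat \<Rightarrow> nat \<Rightarrow> nat" where
  "flip_ix n k = (if k = 1 then n + 1 else if k = n + 1 then 1 else k)"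

lemma flip_ix_flip_ix [simp]: "flip_ix n (flip_ix n k) = k"
  by (auto simp: flip_ix_def)

lemma flip_ix_mem [simp]: "flip_ix n k \<in> ix n \<longleftrightarrow> k \<in> ix n"
  by (auto simp: flip_ix_def ix_def)

lemma flip_ix_eq_iff [simp]: "flip_ix n i = flip_ix n j \<longleftrightarrow> i = j"
  by (metis flip_ix_flip_ix)

lemma bij_betw_flip_ix: "bij_betw (flip_ix n) (ix n) (ix n)"
  by (rule bij_betw_byWitness[where f' = "flip_ix n"]) (auto)

lemma sum_flip_ix: "(\<Sum>k\<in>ix n. g (flip_ix n k)) = sum g (ix n)"
  by (rule sum.reindex_bij_betw[OF bij_betw_flip_ix])

text \<open>For n at least 1 the indices 1 and n+1 are distinct, so the two end terms of the form
  are exactly the summands at the two swapped indices.\<close>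

lemma hform_eq_sum:
  assumes "n \<ge> 1"
  shows "hform n z w = (\<Sum>k\<in>ix n. qmul (qconj (w (flip_ix n k))) (z k))"
proof -
  have "ix n = insert 1 (insert (n+1) {2..n})" using assms by (auto simp: ix_def)
  moreover have "(\<Sum>k\<in>{2..n}. qmul (qconj (w (flip_ix n k))) (z k)) = (\<Sum>i\<in>{2..n}. qmul (qconj (w i)) (z i))"
    by (rule sum.cong) (auto simp: flip_ix_def)
  ultimately show ?thesis
    using assms by (simp add: hform_def flip_ix_def)
qed

definition supported :: "nat \<Rightarrow> qmat \<Rightarrow> bool" where
  "supported n A \<longleftrightarrow> (\<forall>i j. \<not> (i \<in> ix n \<and> j \<in> ix n) \<longrightarrow> A i j = 0)"

lemma supported_eqI:
  assumes "supported n A" "supported n B"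
    and "\<And>i j. i \<in> ix n \<Longrightarrow> j \<in> ix n \<Longrightarrow> A i j = B i j"
  shows "A = B"
  using assms unfolding supported_def by (intro ext) metis

text \<open>The adjoint with respect to the form; on Sp(n,1) it is the inverse.\<close>

definition qadj :: "nat \<Rightarrow> qmat \<Rightarrow> qmat" where
  "qadj n A = (\<lambda>i j. if i \<in> ix n \<and> j \<in> ix n
                      then qconj (A (flip_ix n j) (flip_ix n i)) else 0)"

lemma supported_qmat_mult [simp]: "supported n (qmat_mult n A B)"
  by (simp add: supported_def qmat_mult_def ix_def)

lemma supported_qmat_id [simp]: "supported n (qmat_id n)"
  by (auto simp: supported_def qmat_id_def ix_def)

lemma supported_qadj [simp]: "supported n (qadj n A)"
  by (auto simp: supported_def qadj_def)

lemma qmat_mult_nth: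
  "i \<in> ix n \<Longrightarrow> j \<in> ix n \<Longrightarrow> qmat_mult n A B i j = (\<Sum>k\<in>ix n. qmul (A i k) (B k j))"
  by (simp add: qmat_mult_def ix_def)

lemma qmat_id_nth: "i \<in> ix n \<Longrightarrow> j \<in> ix n \<Longrightarrow> qmat_id n i j = (if i = j then qone else 0)"
  by (auto simp: qmat_id_def ix_def)

lemma qadj_nth:
  "i \<in> ix n \<Longrightarrow> j \<in> ix n \<Longrightarrow> qadj n A i j = qconj (A (flip_ix n j) (flip_ix n i))"
  by (simp add: qadj_def)

lemma qmat_mult_assoc: "qmat_mult n (qmat_mult n A B) C = qmat_mult n A (qmat_mult n B C)"
proof (rule supported_eqI[where n = n])
  fix i j assume ij: "i \<in> ix n" "j \<in> ix n"
  have "qmat_mult n (qmat_mult n A B) C i j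
      = (\<Sum>k\<in>ix n. \<Sum>l\<in>ix n. qmul (A i l) (qmul (B l k) (C k j)))"
    unfolding qmat_mult_nth[OF ij]
    by (intro sum.cong refl) (simp add: qmat_mult_nth[OF ij(1)] qmul.sum_left qmul_assoc)
  also have "\<dots> = (\<Sum>l\<in>ix n. \<Sum>k\<in>ix n. qmul (A i l) (qmul (B l k) (C k j)))"
    by (rule sum.swap)
  also have "\<dots> = qmat_mult n A (qmat_mult n B C) i j"
    unfolding qmat_mult_nth[OF ij]
    by (intro sum.cong refl) (simp add: qmat_mult_nth[OF _ ij(2)] qmul.sum_right)
  finally show "qmat_mult n (qmat_mult n A B) C i j = qmat_mult n A (qmat_mult n B C) i j" .
qed simp_all

lemma qmat_mult_id_left [simp]:
  assumes "supported n A" shows "qmat_mult n (qmat_id n) A = A"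
proof (rule supported_eqI[where n = n])
  fix i j assume ij: "i \<in> ix n" "j \<in> ix n"
  have "qmat_mult n (qmat_id n) A i j = (\<Sum>k\<in>ix n. if k = i then A k j else 0)"
    unfolding qmat_mult_nth[OF ij] using ij by (intro sum.cong refl) (auto simp: qmat_id_nth)
  also have "\<dots> = A i j" using ij by simp
  finally show "qmat_mult n (qmat_id n) A i j = A i j" .
qed (use assms in simp_all)

lemma qmat_mult_id_right [simp]:
  assumes "supported n A" shows "qmat_mult n A (qmat_id n) = A"
proof (rule supported_eqI[where n = n])
  fix i j assume ij: "i \<in> ix n" "j \<in> ix n"
  have "qmat_mult n A (qmat_id n) i j = (\<Sum>k\<in>ix n. if k = j then A i k else 0)"
    unfolding qmat_mult_nth[OF ij] using ij by (intro sum.cong refl) (auto simp: qmat_id_nth)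
  also have "\<dots> = A i j" using ij by simp
  finally show "qmat_mult n A (qmat_id n) i j = A i j" .
qed (use assms in simp_all)

lemma qadj_qadj [simp]: "supported n A \<Longrightarrow> qadj n (qadj n A) = A"
  by (rule supported_eqI[where n = n]) (simp_all add: qadj_nth)

lemma qadj_mult: "qadj n (qmat_mult n A B) = qmat_mult n (qadj n B) (qadj n A)"
proof (rule supported_eqI[where n = n])
  fix i j assume ij: "i \<in> ix n" "j \<in> ix n"
  have "qadj n (qmat_mult n A B) i j
     = (\<Sum>k\<in>ix n. qmul (qconj (B k (flip_ix n i))) (qconj (A (flip_ix n j) k)))"
    using ij by (simp add: qadj_nth qmat_mult_nth qconj_sum qconj_qmul)
  \<comment> \<open>The inner index is flipped as well, so that both factors take the shape of
    entries of \<open>qadj\<close>.\<close>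
  also have "\<dots> = (\<Sum>k\<in>ix n. qmul (qconj (B (flip_ix n k) (flip_ix n i))) (qconj (A (flip_ix n j) (flip_ix n k))))"
    by (rule sum_flip_ix[symmetric])
  also have "\<dots> = qmat_mult n (qadj n B) (qadj n A) i j"
    unfolding qmat_mult_nth[OF ij] using ij by (intro sum.cong refl) (simp add: qadj_nth)
  finally show "qadj n (qmat_mult n A B) i j = qmat_mult n (qadj n B) (qadj n A) i j" .
qed simp_all

lemma qadj_id [simp]: "qadj n (qmat_id n) = qmat_id n"
  by (rule supported_eqI[where n = n]) (auto simp: qadj_nth qmat_id_nth)

lemma uminus_qmat_nth [simp]: "(- A) i j = - A i j" for A :: qmat
  by simp

lemma qmat_mult_minus_left: "qmat_mult n (- A) B = - qmat_mult n A B"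
  by (intro ext) (simp add: qmat_mult_def qmul.minus_left sum_negf)

lemma qmat_mult_minus_right: "qmat_mult n A (- B) = - qmat_mult n A B"
  by (intro ext) (simp add: qmat_mult_def qmul.minus_right sum_negf)

lemma minus_minus_qmat [simp]: "- (- A) = A" for A :: qmat
  by (intro ext) simp

lemma qadj_minus: "qadj n (- A) = - qadj n A"
  by (intro ext) (simp add: qadj_def qconj_minus)

text \<open>Multiplication by a quaternion matrix is real linear, so that one-sided inverses are
  two-sided because they are for real matrices.\<close>

definition realify :: "nat \<Rightarrow> qmat \<Rightarrow> real mat" where
  "realify n A = mat ((n+1)*4) ((n+1)*4)
     (\<lambda>(i, j). qmul (A (Suc (i div 4)) (Suc (j div 4))) (axis (of_nat (j mod 4)) 1) $ of_nat (i mod 4))"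

text \<open>In the index type \<open>4\<close> the numeral 4 equals 0, so \<open>of_nat\<close> runs
  through the components in the order 4, 1, 2, 3.\<close>

lemma index_4_eq_0: "f (0::4) = f 4"
  by (rule arg_cong[of _ _ f]) simp

lemma sum_of_nat_4: "(\<Sum>s<4. g (of_nat s :: 4)) = (\<Sum>k\<in>UNIV. g k)" for g :: "4 \<Rightarrow> real"
  using index_4_eq_0[of g] by (simp add: lessThan_nat_numeral sum_4 eval_nat_numeral)

text \<open>A flat index k encodes the quaternionic index \<open>Suc (k div 4)\<close> together with
  the component \<open>k mod 4\<close>; the sum is grouped into blocks of four.\<close>

lemma sum_div_mod_4: "(\<Sum>k<(n+1)*4. g (Suc (k div 4)) (k mod 4)) = (\<Sum>k\<in>ix n. \<Sum>s<4. g k s)"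
  for g :: "nat \<Rightarrow> nat \<Rightarrow> real"
proof -
  have "(\<Sum>k<(n+1)*4. g (Suc (k div 4)) (k mod 4))
      = (\<Sum>m<n+1. \<Sum>k\<in>{m*4..<m*4+4}. g (Suc (k div 4)) (k mod 4))"
    by (rule sum.nat_group[symmetric])
  also have "\<dots> = (\<Sum>m<n+1. \<Sum>s<4. g (Suc m) s)"
  proof (rule sum.cong[OF refl])
    fix m
    have "(\<Sum>k\<in>{m*4..<m*4+4}. g (Suc (k div 4)) (k mod 4))
       = (\<Sum>s\<in>{0..<4}. g (Suc ((s + m*4) div 4)) ((s + m*4) mod 4))"
      using sum.shift_bounds_nat_ivl[of "\<lambda>k. g (Suc (k div 4)) (k mod 4)" 0 "m*4" 4]
      by (simp add: add.commute)
    then show "(\<Sum>k\<in>{m*4..<m*4+4}. g (Suc (k div 4)) (k mod 4)) = (\<Sum>s<4. g (Suc m) s)"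
      by (auto simp: lessThan_atLeast0 intro!: sum.cong)
  qed
  also have "\<dots> = (\<Sum>k\<in>ix n. \<Sum>s<4. g k s)"
    by (simp add: ix_def sum.atLeast1_atMost_eq del: sum.lessThan_Suc sum.cl_ivl_Suc)
  finally show ?thesis .
qed

lemma realify_nth:
  assumes "i \<in> ix n" "j \<in> ix n" "r < 4" "s < 4"
  shows "realify n A $$ ((i-1)*4 + r, (j-1)*4 + s) = qmul (A i j) (axis (of_nat s) 1) $ of_nat r"
proof -
  have "(i-1)*4 + r < (n+1)*4" "(j-1)*4 + s < (n+1)*4" using assms by (auto simp: ix_def)
  moreover have "Suc (((i-1)*4 + r) div 4) = i" "((i-1)*4 + r) mod 4 = r"
    "Suc (((j-1)*4 + s) div 4) = j" "((j-1)*4 + s) mod 4 = s" using assms by (auto simp: ix_def)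
  ultimately show ?thesis by (simp only: realify_def index_mat split)
qed

lemma realify_mult: "realify n (qmat_mult n A B) = realify n A * realify n B"
proof (rule eq_matI)
  fix i j assume "i < dim_row (realify n A * realify n B)" "j < dim_col (realify n A * realify n B)"
  then have ij: "i < (n+1)*4" "j < (n+1)*4" by (simp_all add: realify_def)
  let ?i = "Suc (i div 4)" and ?j = "Suc (j div 4)"
  let ?e = "axis (of_nat (j mod 4)) 1 :: quat" and ?r = "of_nat (i mod 4) :: 4"
  have mem: "?i \<in> ix n" "?j \<in> ix n" using ij by (auto simp: ix_def)
  \<comment> \<open>Real linearity of left multiplication by p, applied to the expansion of q in the
    standard basis.\<close>
  have expand: "(\<Sum>s<4. qmul p (axis (of_nat s) 1) $ ?r * q $ of_nat s) = qmul p q $ ?r" for p q :: quat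
  proof -
    have "qmul p q $ ?r = qmul p (\<Sum>s\<in>UNIV. (q $ s) *\<^sub>R axis s 1) $ ?r"
      using basis_expansion[of q] by (simp add: scalar_mult_eq_scaleR)
    also have "\<dots> = (\<Sum>s\<in>UNIV. qmul p (axis s 1) $ ?r * q $ s)"
      by (simp add: qmul.sum_right qmul.scaleR_right mult.commute)
    finally show ?thesis by (simp add: sum_of_nat_4[where g = "\<lambda>s. qmul p (axis s 1) $ ?r * q $ s"])
  qed
  have "(realify n A * realify n B) $$ (i, j)
     = (\<Sum>k<(n+1)*4. qmul (A ?i (Suc (k div 4))) (axis (of_nat (k mod 4)) 1) $ ?r
                 * qmul (B (Suc (k div 4)) ?j) ?e $ of_nat (k mod 4))"
    using ij by (simp add: realify_def scalar_prod_def lessThan_atLeast0)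
  also have "\<dots> = (\<Sum>k\<in>ix n. \<Sum>s<4. qmul (A ?i k) (axis (of_nat s) 1) $ ?r
                 * qmul (B k ?j) ?e $ of_nat s)"
    by (rule sum_div_mod_4[where g = "\<lambda>k s. qmul (A ?i k) (axis (of_nat s) 1) $ ?r
                 * qmul (B k ?j) ?e $ of_nat s"])
  also have "\<dots> = (\<Sum>k\<in>ix n. qmul (qmul (A ?i k) (B k ?j)) ?e $ ?r)"
    by (simp add: expand qmul_assoc)
  also have "\<dots> = qmul (qmat_mult n A B ?i ?j) ?e $ ?r"
    unfolding qmat_mult_nth[OF mem] by (simp add: qmul.sum_left)
  also have "\<dots> = realify n (qmat_mult n A B) $$ (i, j)"
    using ij by (simp add: realify_def)
  finally show "realify n (qmat_mult n A B) $$ (i, j) = (realify n A * realify n B) $$ (i, j)" by simp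
qed (simp_all add: realify_def)

lemma of_nat_4_eq_iff: "a < 4 \<Longrightarrow> b < 4 \<Longrightarrow> (of_nat a :: 4) = of_nat b \<longleftrightarrow> a = b"
  by (auto simp: less_Suc_eq eval_nat_numeral)

lemma realify_id: "realify n (qmat_id n) = 1\<^sub>m ((n+1)*4)"
proof (rule eq_matI)
  fix i j assume "i < dim_row (1\<^sub>m ((n+1)*4) :: real mat)" "j < dim_col (1\<^sub>m ((n+1)*4) :: real mat)"
  then have ij: "i < (n+1)*4" "j < (n+1)*4" by simp_all
  have "i div 4 = j div 4 \<and> i mod 4 = j mod 4 \<longleftrightarrow> i = j"
    by (metis div_mult_mod_eq)
  then show "realify n (qmat_id n) $$ (i, j) = 1\<^sub>m ((n+1)*4) $$ (i, j)"
    using ij by (auto simp: realify_def qmat_id_def axis_def of_nat_4_eq_iff ix_def qmul.zero_left)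
qed (simp_all add: realify_def)

lemma realify_inject:
  assumes "supported n A" "supported n B" "realify n A = realify n B"
  shows "A = B"
proof (rule supported_eqI[OF assms(1,2)])
  fix i j assume ij: "i \<in> ix n" "j \<in> ix n"
  have "A i j $ of_nat r = B i j $ of_nat r" if "r < 4" for r
  proof -
    \<comment> \<open>The column of a block that belongs to the basis vector 1 is the quaternionic
      entry itself.\<close>
    have "axis 1 1 = qone" by (simp add: quat_eq_iff qone_def axis_def)
    then show ?thesis
      using realify_nth[OF ij that, of 1 A] realify_nth[OF ij that, of 1 B] assms(3) by simp
  qed
  from this[of 0] this[of 1] this[of 2] this[of 3] show "A i j = B i j"
    using index_4_eq_0[of "($) (A i j)"] index_4_eq_0[of "($) (B i j)"] by (simp add: quat_eq_iff)
qed

lemma qmat_left_inverse_imp_right: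
  assumes "supported n A" "supported n B" "qmat_mult n B A = qmat_id n"
  shows "qmat_mult n A B = qmat_id n"
proof (rule realify_inject[where n = n])
  have "realify n A \<in> carrier_mat ((n+1)*4) ((n+1)*4)" "realify n B \<in> carrier_mat ((n+1)*4) ((n+1)*4)"
    by (simp_all add: realify_def)
  then show "realify n (qmat_mult n A B) = realify n (qmat_id n)"
    using mat_mult_left_right_inverse[of "realify n B" "(n+1)*4" "realify n A"] assms(3)
    by (metis realify_id realify_mult)
qed simp_all

section \<open>The group Sp(n,1) and the reversal defect\<close>

definition unit_vec :: "nat \<Rightarrow> qvec" where
  "unit_vec j = (\<lambda>k. if k = j then qone else 0)"

lemma qmat_apply_eq: "qmat_apply n A z i = (\<Sum>k\<in>ix n. qmul (A i k) (z k))"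
  by (simp add: qmat_apply_def ix_def)

lemma hform_unit_left:
  assumes "n \<ge> 1" "j \<in> ix n"
  shows "hform n (unit_vec j) w = qconj (w (flip_ix n j))"
proof -
  have "hform n (unit_vec j) w = (\<Sum>k\<in>ix n. if k = j then qconj (w (flip_ix n k)) else 0)"
    unfolding hform_eq_sum[OF assms(1)] by (rule sum.cong) (auto simp: unit_vec_def qmul.zero_right)
  then show ?thesis using assms by simp
qed

lemma hform_qmat_apply:
  assumes "n \<ge> 1"
  shows "hform n (qmat_apply n A z) (qmat_apply n A w)
    = (\<Sum>l\<in>ix n. \<Sum>m\<in>ix n.
        qmul (qconj (w (flip_ix n l))) (qmul (qmat_mult n (qadj n A) A l m) (z m)))"
proof -
  let ?t = "\<lambda>k l m. qmul (qconj (w l)) (qmul (qconj (A (flip_ix n k) l)) (qmul (A k m) (z m)))"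
  have "hform n (qmat_apply n A z) (qmat_apply n A w) = (\<Sum>k\<in>ix n. \<Sum>l\<in>ix n. \<Sum>m\<in>ix n. ?t k l m)"
    unfolding hform_eq_sum[OF assms]
    by (simp add: qmat_apply_eq qconj_sum qconj_qmul qmul.sum_left qmul_assoc) (simp add: qmul.sum_right)
  also have "\<dots> = (\<Sum>l\<in>ix n. \<Sum>k\<in>ix n. \<Sum>m\<in>ix n. ?t k l m)"
    by (rule sum.swap)
  also have "\<dots> = (\<Sum>l\<in>ix n. \<Sum>m\<in>ix n. \<Sum>k\<in>ix n. ?t k l m)"
    by (intro sum.cong refl sum.swap)
  \<comment> \<open>After flipping l the conjugated entry of A is an entry of
    \<open>qadj n A\<close>.\<close>
  also have "\<dots> = (\<Sum>l\<in>ix n. \<Sum>m\<in>ix n. \<Sum>k\<in>ix n. ?t k (flip_ix n l) m)"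
    by (rule sum_flip_ix[symmetric])
  also have "\<dots> = (\<Sum>l\<in>ix n. \<Sum>m\<in>ix n.
        qmul (qconj (w (flip_ix n l))) (qmul (qmat_mult n (qadj n A) A l m) (z m)))"
    by (intro sum.cong refl)
      (simp add: qmat_mult_nth qadj_nth qmul.sum_left qmul.sum_right qmul_assoc)
  finally show ?thesis .
qed

text \<open>Evaluating the form on unit vectors reads off the entries of
  \<open>qmat_mult n (qadj n A) A\<close>, which turns invariance of the form into one matrix
  equation.\<close>

lemma Sp_iff:
  assumes "n \<ge> 1"
  shows "A \<in> Sp n \<longleftrightarrow> supported n A \<and> qmat_mult n (qadj n A) A = qmat_id n"
proof
  assume A: "A \<in> Sp n"
  have "qmat_mult n (qadj n A) A = qmat_id n"
  proof (rule supported_eqI[where n = n])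
    fix i j assume ij: "i \<in> ix n" "j \<in> ix n"
    let ?G = "qmat_mult n (qadj n A) A"
    \<comment> \<open>The second test vector sits at the flipped index, which cancels the flip in
      the form.\<close>
    have "(\<Sum>l\<in>ix n. \<Sum>m\<in>ix n. qmul (qconj (unit_vec (flip_ix n i) (flip_ix n l))) (qmul (?G l m) (unit_vec j m)))
      = (\<Sum>l\<in>ix n. \<Sum>m\<in>ix n. if l = i then if m = j then ?G l m else 0 else 0)"
      by (intro sum.cong refl) (auto simp: unit_vec_def qmul.zero_left qmul.zero_right)
    also have "\<dots> = (\<Sum>l\<in>ix n. if l = i then \<Sum>m\<in>ix n. if m = j then ?G l m else 0 else 0)"
      by (intro sum.cong refl) auto
    also have "\<dots> = ?G i j" using ij by simp
    finally have "hform n (qmat_apply n A (unit_vec j)) (qmat_apply n A (unit_vec (flip_ix n i))) = ?G i j"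
      by (simp add: hform_qmat_apply[OF assms])
    moreover have "hform n (qmat_apply n A (unit_vec j)) (qmat_apply n A (unit_vec (flip_ix n i)))
        = hform n (unit_vec j) (unit_vec (flip_ix n i))"
      using A by (simp add: Sp_def)
    moreover have "hform n (unit_vec j) (unit_vec (flip_ix n i)) = qmat_id n i j"
      using ij by (simp add: hform_unit_left[OF assms]) (auto simp: unit_vec_def qmat_id_nth)
    ultimately show "?G i j = qmat_id n i j" by simp
  qed simp_all
  with A show "supported n A \<and> qmat_mult n (qadj n A) A = qmat_id n"
    by (simp add: Sp_def supported_def ix_def)
next
  assume A: "supported n A \<and> qmat_mult n (qadj n A) A = qmat_id n"
  have "hform n (qmat_apply n A z) (qmat_apply n A w) = hform n z w" for z w
  proof -
    have "hform n (qmat_apply n A z) (qmat_apply n A w)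
      = (\<Sum>l\<in>ix n. \<Sum>m\<in>ix n. if l = m then qmul (qconj (w (flip_ix n l))) (z m) else 0)"
      unfolding hform_qmat_apply[OF assms] using A
      by (intro sum.cong refl) (auto simp: qmat_id_nth qmul.zero_left qmul.zero_right)
    also have "\<dots> = hform n z w"
      by (simp add: hform_eq_sum[OF assms])
    finally show ?thesis .
  qed
  with A show "A \<in> Sp n"
    by (simp add: Sp_def supported_def ix_def)
qed

lemma Sp_supported: "A \<in> Sp n \<Longrightarrow> supported n A"
  by (simp add: Sp_def supported_def ix_def)

lemma Sp_adj_left: "n \<ge> 1 \<Longrightarrow> A \<in> Sp n \<Longrightarrow> qmat_mult n (qadj n A) A = qmat_id n"
  by (simp add: Sp_iff)

lemma Sp_adj_right: "n \<ge> 1 \<Longrightarrow> A \<in> Sp n \<Longrightarrow> qmat_mult n A (qadj n A) = qmat_id n"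
  by (rule qmat_left_inverse_imp_right) (simp_all add: Sp_adj_left Sp_supported)

lemma Sp_mult:
  assumes "n \<ge> 1" "A \<in> Sp n" "B \<in> Sp n" shows "qmat_mult n A B \<in> Sp n"
proof -
  have "qmat_mult n (qadj n A) (qmat_mult n A B) = B"
    using assms by (simp add: Sp_adj_left Sp_supported flip: qmat_mult_assoc)
  then show ?thesis
    using assms by (simp add: Sp_iff[OF assms(1), of "qmat_mult n A B"] qadj_mult qmat_mult_assoc Sp_adj_left)
qed

lemma Sp_adj: "n \<ge> 1 \<Longrightarrow> A \<in> Sp n \<Longrightarrow> qadj n A \<in> Sp n"
  by (simp add: Sp_iff[of n "qadj n A"] Sp_adj_right Sp_supported)

lemma Sp_minus: "n \<ge> 1 \<Longrightarrow> A \<in> Sp n \<Longrightarrow> - A \<in> Sp n"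
  by (simp add: Sp_iff qadj_minus qmat_mult_minus_left qmat_mult_minus_right)
    (simp add: supported_def)

definition scale_qmat :: "real \<Rightarrow> qmat \<Rightarrow> qmat" where
  "scale_qmat s A = (\<lambda>i j. s *\<^sub>R A i j)"

lemma scale_qmat_scale [simp]: "scale_qmat s (scale_qmat t A) = scale_qmat (s * t) A"
  by (simp add: scale_qmat_def)

lemma scale_qmat_1 [simp]: "scale_qmat 1 A = A"
  by (simp add: scale_qmat_def)

lemma uminus_eq_scale_qmat: "- A = scale_qmat (-1) A"
  by (intro ext) (simp add: scale_qmat_def)

lemma qmat_mult_scale_left: "qmat_mult n (scale_qmat s A) B = scale_qmat s (qmat_mult n A B)"
  by (intro ext) (simp add: qmat_mult_def scale_qmat_def qmul.scaleR_left scaleR_sum_right del: sum.cl_ivl_Suc)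

lemma qmat_mult_scale_right: "qmat_mult n A (scale_qmat s B) = scale_qmat s (qmat_mult n A B)"
  by (intro ext) (simp add: qmat_mult_def scale_qmat_def qmul.scaleR_right scaleR_sum_right del: sum.cl_ivl_Suc)

section \<open>The real trace, words in two matrices and the reversal defect\<close>

definition retr :: "nat \<Rightarrow> qmat \<Rightarrow> real" where
  "retr n A = (\<Sum>i\<in>ix n. A i i $ 1)"

lemma retr_mult: "retr n (qmat_mult n A B) = (\<Sum>i\<in>ix n. \<Sum>k\<in>ix n. qmul (A i k) (B k i) $ 1)"
  unfolding retr_def by (intro sum.cong refl) (simp add: qmat_mult_nth)

text \<open>The real part is taken because Re (p q) = Re (q p), whereas p q and q p differ in
  general; this makes the trace cyclic.\<close>

lemma retr_mult_commute: "retr n (qmat_mult n A B) = retr n (qmat_mult n B A)"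
proof -
  have "retr n (qmat_mult n A B) = (\<Sum>k\<in>ix n. \<Sum>i\<in>ix n. qmul (A i k) (B k i) $ 1)"
    unfolding retr_mult by (rule sum.swap)
  also have "\<dots> = retr n (qmat_mult n B A)"
    unfolding retr_mult by (intro sum.cong refl Re_qmul_commute)
  finally show ?thesis .
qed

lemma retr_qadj: "retr n (qadj n A) = retr n A"
  using sum_flip_ix[of "\<lambda>i. A i i $ 1" n] by (simp add: retr_def qadj_nth)

lemma retr_scale: "retr n (scale_qmat s A) = s * retr n A"
  by (simp add: retr_def scale_qmat_def sum_distrib_left)

fun word :: "nat \<Rightarrow> qmat \<Rightarrow> qmat \<Rightarrow> bool list \<Rightarrow> qmat" where
  "word n a b [] = qmat_id n"
| "word n a b (x # w) = qmat_mult n (if x then a else b) (word n a b w)"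

lemma supported_word [simp]: "supported n (word n a b w)"
  by (cases w) simp_all

lemma word_append: "word n a b (u @ w) = qmat_mult n (word n a b u) (word n a b w)"
  by (induction u) (simp_all add: qmat_mult_assoc)

lemma word_qadj: 
  assumes "supported n a" "supported n b"
  shows "qadj n (word n a b w) = word n (qadj n a) (qadj n b) (rev w)"
  by (induction w) (simp_all add: word_append qadj_mult)

lemma word_scale: "word n (scale_qmat s a) (scale_qmat t b) w
   = scale_qmat (s ^ count_list w True * t ^ count_list w False) (word n a b w)"
  by (induction w) (simp_all add: qmat_mult_scale_left qmat_mult_scale_right mult_ac)

text \<open>Between neighbouring letters the factors h g cancel.\<close>

lemma word_conj:
  assumes "qmat_mult n h g = qmat_id n" "qmat_mult n g h = qmat_id n" "supported n h"
  shows "word n (qmat_mult n g (qmat_mult n a h)) (qmat_mult n g (qmat_mult n b h)) w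
       = qmat_mult n g (qmat_mult n (word n a b w) h)"
proof (induction w)
  case Nil
  show ?case using assms by simp
next
  case (Cons x w)
  have "qmat_mult n h (qmat_mult n g (qmat_mult n (word n a b w) h)) = qmat_mult n (word n a b w) h"
    by (simp add: assms(1) flip: qmat_mult_assoc)
  with Cons show ?case by (simp add: qmat_mult_assoc)
qed

text \<open>The second word is the first one reversed. Both contain each letter four times, so
  scaling a letter enters only through its fourth power.\<close>

definition rev_defect :: "nat \<Rightarrow> qmat \<Rightarrow> qmat \<Rightarrow> real" where
  "rev_defect n a b = 
     retr n (word n a b [True, True, True, False, True, False, False, False])
   - retr n (word n a b [False, False, False, True, False, True, True, True])"

lemma rev_defect_scale: "rev_defect n (scale_qmat s a) (scale_qmat t b) = s^4 * t^4 * rev_defect n a b"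
  unfolding rev_defect_def word_scale retr_scale
  by (simp del: word.simps add: right_diff_distrib power4_eq_xxxx mult.assoc)

text \<open>Conjugation by g turns the word in a and b into the same word in their adjoints, up to
  signs, and the adjoint of a word is the reversed word in the adjoints. The signs s and t arise
  when relations between projective classes are lifted to matrices.\<close>

lemma rev_defect_eq_0:
  assumes n: "n \<ge> 1" and g: "g \<in> Sp n" and a: "a \<in> Sp n" and b: "b \<in> Sp n"
    and ga: "qmat_mult n g (qmat_mult n a (qadj n g)) = scale_qmat s (qadj n a)"
    and gb: "qmat_mult n g (qmat_mult n b (qadj n g)) = scale_qmat t (qadj n b)"
    and st: "s = 1 \<or> s = -1" "t = 1 \<or> t = -1"
  shows "rev_defect n a b = 0"
proof -
  have inv: "qmat_mult n (qadj n g) g = qmat_id n" "qmat_mult n g (qadj n g) = qmat_id n"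
    using n g by (simp_all add: Sp_adj_left Sp_adj_right)
  let ?w = "[True, True, True, False, True, False, False, False]"
  have "retr n (word n a b ?w) = retr n (qmat_mult n g (qmat_mult n (word n a b ?w) (qadj n g)))"
    using retr_mult_commute[of n g "qmat_mult n (word n a b ?w) (qadj n g)"]
    by (simp only: qmat_mult_assoc inv(1) qmat_mult_id_right[OF supported_word])
  also have "\<dots> = retr n (word n (scale_qmat s (qadj n a)) (scale_qmat t (qadj n b)) ?w)"
    using word_conj[OF inv supported_qadj, of a b ?w] by (simp only: ga gb)
  also have "\<dots> = s^4 * t^4 * retr n (word n (qadj n a) (qadj n b) ?w)"
    unfolding word_scale retr_scale by (simp del: word.simps add: power4_eq_xxxx)
  also have "\<dots> = retr n (word n (qadj n a) (qadj n b) ?w)"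
    using st by (auto simp del: word.simps)
  also have "\<dots> = retr n (qadj n (word n a b (rev ?w)))"
    using a b by (simp only: word_qadj Sp_supported rev_rev_ident)
  also have "\<dots> = retr n (word n a b (rev ?w))"
    by (rule retr_qadj)
  finally show ?thesis by (simp only: rev_defect_def rev.simps append.simps)
qed

section \<open>Transvections\<close>

text \<open>The linear map that sends z to v c <z, u>.\<close>

definition rank1 :: "nat \<Rightarrow> qvec \<Rightarrow> quat \<Rightarrow> qvec \<Rightarrow> qmat" where
  "rank1 n v c u = (\<lambda>i j. if i \<in> ix n \<and> j \<in> ix n
                          then qmul (v i) (qmul c (qconj (u (flip_ix n j)))) else 0)"

lemma rank1_nth: "i \<in> ix n \<Longrightarrow> j \<in> ix n \<Longrightarrow>
    rank1 n v c u i j = qmul (v i) (qmul c (qconj (u (flip_ix n j))))"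
  by (simp add: rank1_def)

lemma supported_rank1 [simp]: "supported n (rank1 n v c u)"
  by (auto simp: rank1_def supported_def)

lemma rank1_mult:
  assumes "n \<ge> 1"
  shows "qmat_mult n (rank1 n v c u) (rank1 n w d z) = rank1 n v (qmul c (qmul (hform n w u) d)) z"
  by (rule supported_eqI[where n = n])
    (simp_all add: qmat_mult_nth rank1_nth hform_eq_sum[OF assms] qmul.sum_left qmul.sum_right qmul_assoc)

lemma qadj_rank1: "qadj n (rank1 n v c u) = rank1 n u (qconj c) v"
  by (rule supported_eqI[where n = n]) (simp_all add: qadj_nth rank1_nth qconj_qmul qmul_assoc)

text \<open>Since A preserves the form, the functional \<open><., A u>\<close> composed with A is
  \<open><., u>\<close>. Right multiplication by A therefore only moves the covector.\<close>

lemma rank1_mult_Sp: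
  assumes "n \<ge> 1" "A \<in> Sp n"
  shows "qmat_mult n (rank1 n v c (qmat_apply n A u)) A = rank1 n v c u"
proof (rule supported_eqI[where n = n])
  fix i j assume ij: "i \<in> ix n" "j \<in> ix n"
  have col: "qmat_apply n A (unit_vec j) k = A k j" for k
  proof -
    have "qmat_apply n A (unit_vec j) k = (\<Sum>l\<in>ix n. if l = j then A k l else 0)"
      unfolding qmat_apply_eq by (intro sum.cong refl) (auto simp: unit_vec_def qmul.zero_right)
    then show ?thesis using ij by simp
  qed
  have "qmat_mult n (rank1 n v c (qmat_apply n A u)) A i j
      = qmul (v i) (qmul c (hform n (qmat_apply n A (unit_vec j)) (qmat_apply n A u)))"
    using ij by (simp add: qmat_mult_nth rank1_nth hform_eq_sum[OF assms(1)] col qmul.sum_right qmul_assoc)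
  also have "hform n (qmat_apply n A (unit_vec j)) (qmat_apply n A u) = qconj (u (flip_ix n j))"
    using assms ij hform_unit_left[OF assms(1) ij(2)] by (simp add: Sp_def)
  finally show "qmat_mult n (rank1 n v c (qmat_apply n A u)) A i j = rank1 n v c u i j"
    using ij by (simp add: rank1_nth)
qed simp_all

text \<open>By cyclicity of the real part, the trace of z \<mapsto> v c <z, u> is Re (c <v,
  u>).\<close>

lemma retr_rank1:
  assumes "n \<ge> 1"
  shows "retr n (rank1 n v c u) = qmul c (hform n v u) $ 1"
proof -
  have "retr n (rank1 n v c u) = (\<Sum>i\<in>ix n. qmul c (qmul (qconj (u (flip_ix n i))) (v i)) $ 1)"
    unfolding retr_def
    by (intro sum.cong refl) (simp add: rank1_nth Re_qmul_commute[of "v _"] qmul_assoc)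
  then show ?thesis by (simp add: hform_eq_sum[OF assms] qmul.sum_right)
qed

text \<open>The transvections are the case s = 1.  Homogenising in s makes the limit t to infinity the
  evaluation at s = 0.\<close>

definition transv :: "nat \<Rightarrow> qvec \<Rightarrow> quat \<Rightarrow> real \<Rightarrow> real \<Rightarrow> qmat" where
  "transv n v p s t = (\<lambda>i j. s *\<^sub>R qmat_id n i j + t *\<^sub>R rank1 n v p v i j)"

lemma supported_transv [simp]: "supported n (transv n v p s t)"
  using supported_rank1[of n v p v] supported_qmat_id[of n] by (simp add: transv_def supported_def)

lemma transv_0_1 [simp]: "transv n v p 0 1 = rank1 n v p v"
  by (simp add: transv_def)

lemma transv_1_0 [simp]: "transv n v p 1 0 = qmat_id n"
  by (simp add: transv_def)

lemma transv_scale: "s \<noteq> 0 \<Longrightarrow> transv n v p s 1 = scale_qmat s (transv n v p 1 (1 / s))"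
  by (simp add: transv_def scale_qmat_def scaleR_add_right)

lemma transv_mult:
  assumes "supported n B"
  shows "qmat_mult n (transv n v p s t) B i j = s *\<^sub>R B i j + t *\<^sub>R qmat_mult n (rank1 n v p v) B i j"
proof (cases "i \<in> ix n \<and> j \<in> ix n")
  case True
  have "qmat_mult n (transv n v p s t) B i j
    = s *\<^sub>R qmat_mult n (qmat_id n) B i j + t *\<^sub>R qmat_mult n (rank1 n v p v) B i j"
    using True by (simp add: qmat_mult_nth transv_def qmul.add_left qmul.scaleR_left sum.distrib scaleR_sum_right)
  with assms show ?thesis by simp
next
  case False
  then show ?thesis using assms supported_qmat_mult unfolding supported_def by simp
qed

text \<open>For imaginary p the rank one part is skew with respect to the adjoint.\<close>

lemma qadj_transv:
  assumes "qconj p = - p"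
  shows "qadj n (transv n v p 1 t) = transv n v p 1 (- t)"
proof (rule supported_eqI[where n = n])
  fix i j assume ij: "i \<in> ix n" "j \<in> ix n"
  have "qadj n (rank1 n v p v) i j = rank1 n v (- p) v i j" 
    by (simp add: qadj_rank1 assms)
  moreover have "qadj n (qmat_id n) i j = qmat_id n i j" by simp
  ultimately show "qadj n (transv n v p 1 t) i j = transv n v p 1 (- t) i j"
    using ij by (simp add: qadj_nth transv_def qconj_add qconj_scaleR rank1_nth qmul.minus_left qmul.minus_right
        del: qadj_id)
qed simp_all

text \<open>Isotropy of v makes N = \<open>rank1 n v p v\<close> square to zero, so I - t N inverts
  I + t N.\<close>

lemma transv_inverse:
  assumes "n \<ge> 1" "hform n v v = 0"
  shows "qmat_mult n (transv n v p 1 (- t)) (transv n v p 1 t) = qmat_id n"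
proof (intro ext)
  fix i j
  have "qmat_mult n (rank1 n v p v) (transv n v p 1 t) = rank1 n v p v"
  proof (rule supported_eqI[where n = n])
    fix k l assume kl: "k \<in> ix n" "l \<in> ix n"
    have "qmat_mult n (rank1 n v p v) (transv n v p 1 t) k l
       = qmat_mult n (rank1 n v p v) (qmat_id n) k l + t *\<^sub>R qmat_mult n (rank1 n v p v) (rank1 n v p v) k l"
      using kl by (simp add: qmat_mult_nth transv_def qmul.add_right qmul.scaleR_right sum.distrib scaleR_sum_right
          del: qmat_mult_id_right)
    then show "qmat_mult n (rank1 n v p v) (transv n v p 1 t) k l = rank1 n v p v k l"
      using kl by (simp add: rank1_mult[OF assms(1)] assms(2) rank1_nth qmul.zero_left qmul.zero_right)
  qed simp_all
  then show "qmat_mult n (transv n v p 1 (- t)) (transv n v p 1 t) i j = qmat_id n i j"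
    by (simp add: transv_mult) (simp add: transv_def)
qed

lemma transv_Sp:
  assumes "n \<ge> 1" "hform n v v = 0" "qconj p = - p"
  shows "transv n v p 1 t \<in> Sp n"
  using assms by (simp add: Sp_iff qadj_transv transv_inverse)

lemma qconj_hform: "n \<ge> 1 \<Longrightarrow> qconj (hform n z w) = hform n w z"
  by (simp add: hform_def qconj_add qconj_sum qconj_qmul)

section \<open>Explicit isotropic vectors in the plane of the first and last coordinates\<close>

definition pair_vec :: "nat \<Rightarrow> quat \<Rightarrow> quat \<Rightarrow> qvec" where
  "pair_vec n x y = (\<lambda>k. if k = 1 then x else if k = n + 1 then y else 0)"

lemma hform_pair_vec:
  assumes "n \<ge> 1"
  shows "hform n z (pair_vec n x y) = qmul (qconj y) (z 1) + qmul (qconj x) (z (n+1))"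
  using assms by (simp add: hform_def pair_vec_def qmul.zero_left sum.neutral)

lemma qmul_mk_quat [simp]: "qmul (mk_quat a b c d) (mk_quat a' b' c' d') = mk_quat
     (a * a' - b * b' - c * c' - d * d') (a * b' + b * a' + c * d' - d * c')
     (a * c' - b * d' + c * a' + d * b') (a * d' + b * c' - c * b' + d * a')"
  by (simp add: qmul_def)

lemma qconj_mk_quat [simp]: "qconj (mk_quat a b c d) = mk_quat a (-b) (-c) (-d)"
  by (simp add: qconj_def)

lemma add_mk_quat [simp]: "mk_quat a b c d + mk_quat a' b' c' d' = mk_quat (a+a') (b+b') (c+c') (d+d')"
  by (simp add: quat_eq_iff)

lemma zero_eq_mk_quat: "0 = mk_quat 0 0 0 0"
  by (simp add: quat_eq_iff)

text \<open>Found by a search over small quaternions; the values of the form on these vectors and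
  covectors are 1, j, 1, k.\<close>

abbreviation "vec_a n \<equiv> pair_vec n qone 0"
abbreviation "covec_a n \<equiv> pair_vec n 0 qone"
abbreviation "vec_b n \<equiv> pair_vec n (mk_quat 0 0 1 0) qone"
abbreviation "covec_b n \<equiv> pair_vec n (mk_quat 0 0 1 (-1)) qone"
abbreviation "coef_ab \<equiv> mk_quat 1 0 0 1"

lemma pair_vec_isotropic:
  assumes "n \<ge> 1"
  shows "hform n (vec_a n) (vec_a n) = 0" "hform n (covec_a n) (covec_a n) = 0"
    "hform n (vec_b n) (vec_b n) = 0" "hform n (covec_b n) (covec_b n) = 0"
  using assms by (simp_all add: hform_pair_vec[OF assms]) (simp_all add: pair_vec_def qone_def zero_eq_mk_quat)

text \<open>Every word in rank one maps collapses to a rank one map whose coefficient is a product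
  of copies of \<open>coef_ab\<close> and the four values of the form. What remains is quaternion
  arithmetic.\<close>

lemma rev_defect_rank1:
  assumes "n \<ge> 1"
  shows "rev_defect n (rank1 n (vec_a n) coef_ab (covec_a n)) (rank1 n (vec_b n) coef_ab (covec_b n)) = -32"
proof -
  have h: "hform n (vec_a n) (covec_a n) = mk_quat 1 0 0 0" "hform n (vec_b n) (covec_a n) = mk_quat 0 0 1 0"
    "hform n (vec_a n) (covec_b n) = mk_quat 1 0 0 0" "hform n (vec_b n) (covec_b n) = mk_quat 0 0 0 1"
    using assms by (simp_all add: hform_pair_vec[OF assms]) (simp_all add: pair_vec_def qone_def zero_eq_mk_quat)
  show ?thesis
    by (simp add: rev_defect_def rank1_mult[OF assms] retr_rank1[OF assms] h)
qed

section \<open>Curves leaving the zero set\<close>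

lemma qconj_eq_minus_iff: "qconj p = - p \<longleftrightarrow> p $ 1 = 0"
  by (auto simp: quat_eq_iff qconj_def)

text \<open>The ansatz p = c s q^-1 and r = s^-1 with s imaginary gives p q r = c and imaginary r.
  That p is imaginary amounts to Re (s m) = 0 for m = q^-1 c, by cyclicity.\<close>

lemma imaginary_factors:
  assumes "q \<noteq> 0"
  shows "\<exists>p r. qconj p = - p \<and> qconj r = - r \<and> qmul p (qmul q r) = c"
proof -
  define m where "m = qmul (qinv q) c"
  \<comment> \<open>Within the span of j and k, s is orthogonal to the (j, k) part of m: a quarter
    turn of that part, or j if the part vanishes.\<close>
  define s where "s = (if m$3 = 0 \<and> m$4 = 0 then mk_quat 0 0 1 0 else mk_quat 0 0 (m$4) (- m$3))"
  have s0: "s \<noteq> 0" "s $ 1 = 0" by (auto simp: s_def quat_eq_iff)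
  have "qmul s m $ 1 = 0" by (simp add: s_def qmul_def)
  then have "qmul (qmul c s) (qinv q) $ 1 = 0"
    by (metis m_def Re_qmul_commute qmul_assoc)
  moreover have "qinv s $ 1 = 0" using s0 by (simp add: qinv_def)
  moreover have "qmul (qmul (qmul c s) (qinv q)) (qmul q (qinv s)) = c"
  proof -
    have "qmul (qmul (qmul c s) (qinv q)) (qmul q (qinv s))
        = qmul c (qmul s (qmul (qmul (qinv q) q) (qinv s)))" by (simp only: qmul_assoc)
    then show ?thesis using assms s0 by simp
  qed
  ultimately show ?thesis using qconj_eq_minus_iff by metis
qed

text \<open>Three isotropic test vectors suffice. With ends (1, 0) and (0, 1) they read off the last
  and the first coordinate; with ends (1, i) the form is nonzero on any vector that has exactly one
  vanishing end coordinate.\<close>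

lemma common_non_orthogonal:
  assumes "n \<ge> 1" "a 1 \<noteq> 0 \<or> a (n+1) \<noteq> 0" "b 1 \<noteq> 0 \<or> b (n+1) \<noteq> 0"
  shows "\<exists>v. hform n v v = 0 \<and> hform n a v \<noteq> 0 \<and> hform n b v \<noteq> 0"
proof -
  let ?i = "mk_quat 0 1 0 0"
  have i0: "?i \<noteq> 0" "qconj ?i \<noteq> 0" by (simp_all add: quat_eq_iff)
  have iso: "hform n (pair_vec n qone 0) (pair_vec n qone 0) = 0" 
    "hform n (pair_vec n 0 qone) (pair_vec n 0 qone) = 0"
    "hform n (pair_vec n qone ?i) (pair_vec n qone ?i) = 0"
    using assms(1) by (simp_all add: hform_pair_vec[OF assms(1)])
      (simp_all add: pair_vec_def qone_def zero_eq_mk_quat)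
  have h: "hform n z (pair_vec n qone 0) = z (n+1)" "hform n z (pair_vec n 0 qone) = z 1"
    "hform n z (pair_vec n qone ?i) = qmul (qconj ?i) (z 1) + z (n+1)" for z
    using assms(1) by (simp_all add: hform_pair_vec[OF assms(1)] qmul.zero_left del: qconj_mk_quat)
  consider "a (n+1) \<noteq> 0" "b (n+1) \<noteq> 0" | "a 1 \<noteq> 0" "b 1 \<noteq> 0"
    | "a 1 = 0" "a (n+1) \<noteq> 0" "b 1 \<noteq> 0" "b (n+1) = 0" | "a 1 \<noteq> 0" "a (n+1) = 0" "b 1 = 0" "b (n+1) \<noteq> 0"
    using assms(2,3) by blast
  then show ?thesis
  proof cases
    case 3
    then have "hform n a (pair_vec n qone ?i) \<noteq> 0" "hform n b (pair_vec n qone ?i) \<noteq> 0"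
      using h i0 by (simp_all add: qmul.zero_right del: qconj_mk_quat)
    with iso show ?thesis by blast
  next
    case 4
    then have "hform n a (pair_vec n qone ?i) \<noteq> 0" "hform n b (pair_vec n qone ?i) \<noteq> 0"
      using h i0 by (simp_all add: qmul.zero_right del: qconj_mk_quat)
    with iso show ?thesis by blast
  qed (use iso h in metis)+
qed

text \<open>The form is positive definite on the coordinates 2 to n: with vanishing ends, <v, v> is
  a sum of squared norms.\<close>

lemma isotropic_ends:
  assumes "n \<ge> 1" "hform n v v = 0" "v 1 = 0" "v (n+1) = 0" "k \<in> ix n"
  shows "v k = 0"
proof -
  have "hform n v v = (\<Sum>i\<in>{2..n}. (norm (v i))\<^sup>2) *\<^sub>R qone"
    using assms(3,4) by (simp add: hform_def qmul.zero_left qmul.zero_right qmul_qconj_self' scaleR_sum_left)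
  moreover have "qone \<noteq> 0" by (simp add: qone_def quat_eq_iff)
  ultimately have "(\<Sum>i\<in>{2..n}. (norm (v i))\<^sup>2) = 0" using assms(2) by simp
  then have "\<forall>i\<in>{2..n}. v i = 0" by (simp add: sum_nonneg_eq_0_iff)
  then show ?thesis using assms(3-5) by (cases "k = 1 \<or> k = n+1") (auto simp: ix_def)
qed

text \<open>Each coordinate of u is, up to conjugation, the value of the form on a unit vector and
  u, and A preserves this value.\<close>

lemma Sp_apply_inj:
  assumes "n \<ge> 1" "A \<in> Sp n" "\<And>k. k \<in> ix n \<Longrightarrow> qmat_apply n A u k = 0" "j \<in> ix n"
  shows "u j = 0"
proof -
  have "hform n (unit_vec (flip_ix n j)) u
      = hform n (qmat_apply n A (unit_vec (flip_ix n j))) (qmat_apply n A u)"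
    using assms(2) by (simp add: Sp_def)
  also have "\<dots> = 0"
    unfolding hform_eq_sum[OF assms(1)]
    by (intro sum.neutral) (simp add: assms(3) qmul.zero_left)
  finally have "qconj (u j) = 0" using assms(1,4) by (simp add: hform_unit_left)
  then show ?thesis by (metis qconj_qconj qconj_zero)
qed

text \<open>The triple product is v p1 <v2, v> p2 <v3, v2> p3 \<open><., v3>\<close>. Taking v3 = y
  u makes the functional followed by y equal to \<open><., u>\<close>; v2 links v to v3 without a
  vanishing form value, and p1, p3 adjust the scalar to c. In a single factor image and covector
  would coincide and the coefficient would be imaginary.\<close>

lemma transvection_chain:
  assumes n: "n \<ge> 1" and y: "y \<in> Sp n"
    and v: "hform n v v = 0" "v 1 \<noteq> 0 \<or> v (n+1) \<noteq> 0"
    and u: "hform n u u = 0" "k \<in> ix n" "u k \<noteq> 0"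
  shows "\<exists>v2 v3 p1 p2 p3. hform n v2 v2 = 0 \<and> hform n v3 v3 = 0
     \<and> qconj p1 = - p1 \<and> qconj p2 = - p2 \<and> qconj p3 = - p3
     \<and> qmat_mult n (qmat_mult n (rank1 n v p1 v)
          (qmat_mult n (rank1 n v2 p2 v2) (rank1 n v3 p3 v3))) y = rank1 n v c u"
proof -
  define v3 where "v3 = qmat_apply n y u"
  have v3: "hform n v3 v3 = 0" using y u(1) by (simp add: v3_def Sp_def)
  have "v3 1 \<noteq> 0 \<or> v3 (n+1) \<noteq> 0"
    using isotropic_ends[OF n v3] Sp_apply_inj[OF n y _ u(2)] u(3) unfolding v3_def by blast
  then obtain v2 where v2: "hform n v2 v2 = 0" "hform n v v2 \<noteq> 0" "hform n v3 v2 \<noteq> 0"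
    using common_non_orthogonal[of n v v3] n v(2) by blast
  have "hform n v2 v \<noteq> 0" using v2(2) qconj_hform[OF n, of v2 v] by auto
  \<comment> \<open>Any nonzero imaginary quaternion serves here; the scalar is adjusted by p1 and
    p3 alone.\<close>
  define p2 where "p2 = mk_quat 0 1 0 0"
  have p2: "p2 \<noteq> 0" "qconj p2 = - p2" by (simp_all add: p2_def quat_eq_iff)
  let ?q = "qmul (hform n v2 v) (qmul p2 (hform n v3 v2))"
  have "?q \<noteq> 0" using \<open>hform n v2 v \<noteq> 0\<close> p2 v2 by simp
  then obtain p1 p3 where p: "qconj p1 = - p1" "qconj p3 = - p3" "qmul p1 (qmul ?q p3) = c"
    using imaginary_factors by blast
  have "qmat_mult n (qmat_mult n (rank1 n v p1 v)
          (qmat_mult n (rank1 n v2 p2 v2) (rank1 n v3 p3 v3))) y = rank1 n v c u"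
    using p(3) rank1_mult_Sp[OF n y, of v c u] by (simp add: rank1_mult[OF n] v3_def[symmetric] qmul_assoc)
  with v2 v3 p p2 show ?thesis by blast
qed

section \<open>Polynomial curves of matrices and their degrees\<close>

definition rpoly :: "nat \<Rightarrow> (real \<Rightarrow> real) \<Rightarrow> bool" where
  "rpoly d f \<longleftrightarrow> (\<exists>p. degree p \<le> d \<and> (\<forall>t. f t = poly p t))"

definition mpoly :: "nat \<Rightarrow> (real \<Rightarrow> qmat) \<Rightarrow> bool" where
  "mpoly d M \<longleftrightarrow> (\<forall>i j k. rpoly d (\<lambda>t. M t i j $ k))"

lemma rpoly_const: "rpoly d (\<lambda>t. c)"
  unfolding rpoly_def by (rule exI[of _ "[:c:]"]) simp

lemma rpoly_id: "d \<ge> 1 \<Longrightarrow> rpoly d (\<lambda>t. t)"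
  unfolding rpoly_def by (rule exI[of _ "[:0, 1:]"]) simp

lemma rpoly_add: "rpoly d f \<Longrightarrow> rpoly d g \<Longrightarrow> rpoly d (\<lambda>t. f t + g t)"
  unfolding rpoly_def by (metis degree_add_le poly_add)

lemma rpoly_diff: "rpoly d f \<Longrightarrow> rpoly d g \<Longrightarrow> rpoly d (\<lambda>t. f t - g t)"
  unfolding rpoly_def by (metis degree_diff_le poly_diff)

lemma rpoly_mult: "rpoly d f \<Longrightarrow> rpoly e g \<Longrightarrow> rpoly (d + e) (\<lambda>t. f t * g t)"
  unfolding rpoly_def by (metis add_mono degree_mult_le order_trans poly_mult)

lemma rpoly_cmult: "rpoly d f \<Longrightarrow> rpoly d (\<lambda>t. f t * c)"
  using rpoly_mult[of d f 0 "\<lambda>_. c"] rpoly_const by simp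

lemma rpoly_sum: "(\<And>i. i \<in> I \<Longrightarrow> rpoly d (f i)) \<Longrightarrow> rpoly d (\<lambda>t. \<Sum>i\<in>I. f i t)"
  by (induction I rule: infinite_finite_induct) (auto intro: rpoly_const rpoly_add)

lemma rpoly_zeros:
  assumes "rpoly d f" "f t0 \<noteq> 0"
  shows "finite {t. f t = 0}" "card {t. f t = 0} \<le> d"
proof -
  from assms(1) obtain p where p: "degree p \<le> d" "f = poly p" unfolding rpoly_def by auto
  then have "p \<noteq> 0" using assms(2) by auto
  then show "finite {t. f t = 0}" "card {t. f t = 0} \<le> d"
    using p poly_roots_finite[of p] card_poly_roots_bound[of p] by auto
qed

lemma mpoly_const: "mpoly d (\<lambda>t. A)"
  by (simp add: mpoly_def rpoly_const)

lemma mpoly_transv: "mpoly 1 (\<lambda>t. transv n v p 1 t)" "mpoly 1 (\<lambda>s. transv n v p s 1)"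
  by (auto simp: mpoly_def transv_def intro!: rpoly_add rpoly_const rpoly_cmult rpoly_id)

lemma rpoly_qmul:
  assumes "\<And>k. rpoly d (\<lambda>t. p t $ k)" "\<And>k. rpoly e (\<lambda>t. q t $ k)"
  shows "rpoly (d + e) (\<lambda>t. qmul (p t) (q t) $ k)"
proof -
  have "\<forall>k. rpoly (d + e) (\<lambda>t. qmul (p t) (q t) $ k)"
    unfolding forall_4 by (auto simp: qmul_def intro!: rpoly_add rpoly_diff rpoly_mult assms)
  then show ?thesis ..
qed

lemma mpoly_mult:
  assumes "mpoly d M" "mpoly e N"
  shows "mpoly (d + e) (\<lambda>t. qmat_mult n (M t) (N t))"
  unfolding mpoly_def
proof (intro allI)
  fix i j k
  show "rpoly (d + e) (\<lambda>t. qmat_mult n (M t) (N t) i j $ k)"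
  proof (cases "i \<in> ix n \<and> j \<in> ix n")
    case True
    then show ?thesis using assms unfolding mpoly_def
      by (auto simp: qmat_mult_nth intro!: rpoly_sum rpoly_qmul)
  next
    case False
    then have "qmat_mult n (M t) (N t) i j = 0" for t
      using supported_qmat_mult unfolding supported_def by blast
    then show ?thesis by (simp add: rpoly_const)
  qed
qed

lemma mpoly_word:
  assumes "mpoly d a" "mpoly d b"
  shows "mpoly (d * length w) (\<lambda>t. word n (a t) (b t) w)"
proof (induction w)
  case Nil then show ?case by (simp add: mpoly_const)
next
  case (Cons x w)
  have "mpoly d (\<lambda>t. if x then a t else b t)" using assms by (cases x) simp_all
  from mpoly_mult[OF this Cons] show ?case by simp
qed

lemma rpoly_retr: "mpoly d a \<Longrightarrow> rpoly d (\<lambda>t. retr n (a t))"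
  by (simp add: mpoly_def retr_def rpoly_sum)

lemma rpoly_rev_defect:
  assumes "mpoly d a" "mpoly d b"
  shows "rpoly (d * 8) (\<lambda>t. rev_defect n (a t) (b t))"
proof -
  have "rpoly (d * 8) (\<lambda>t. retr n (word n (a t) (b t) w))" if "length w = 8" for w
    using rpoly_retr[OF mpoly_word[OF assms, of w]] that by simp
  then show ?thesis unfolding rev_defect_def by (intro rpoly_diff) (simp_all del: word.simps)
qed

text \<open>X is a curve of triple products of transvections and Y is the same curve seen from
  infinity, so that Y 0 is its leading coefficient, the rank one product of
  \<open>transvection_chain\<close>.\<close>

lemma escape_curve:
  assumes n: "n \<ge> 1" and y: "y \<in> Sp n"
    and v: "hform n v v = 0" "v 1 \<noteq> 0 \<or> v (n+1) \<noteq> 0"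
    and u: "hform n u u = 0" "k \<in> ix n" "u k \<noteq> 0"
  obtains X Y where "\<And>t. X t \<in> Sp n" "X 0 = qmat_id n" "mpoly 3 X" "mpoly 3 Y"
    "\<And>s. s \<noteq> 0 \<Longrightarrow> Y s = scale_qmat (s^3) (X (1/s))" "qmat_mult n (Y 0) y = rank1 n v c u"
proof -
  obtain v2 v3 p1 p2 p3 where iso: "hform n v2 v2 = 0" "hform n v3 v3 = 0"
     and im: "qconj p1 = - p1" "qconj p2 = - p2" "qconj p3 = - p3"
     and eq: "qmat_mult n (qmat_mult n (rank1 n v p1 v)
          (qmat_mult n (rank1 n v2 p2 v2) (rank1 n v3 p3 v3))) y = rank1 n v c u"
    using transvection_chain[OF assms] by metis
  \<comment> \<open>Z is homogeneous of degree 3 in (s, t): s = 1 gives group elements and t = 1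
    gives the chart at infinity.\<close>
  define Z where "Z = (\<lambda>s t. qmat_mult n (transv n v p1 s t) 
     (qmat_mult n (transv n v2 p2 s t) (transv n v3 p3 s t)))"
  show thesis
  proof (rule that[of "\<lambda>t. Z 1 t" "\<lambda>s. Z s 1"])
    show "Z 1 t \<in> Sp n" for t
      unfolding Z_def using n iso im v by (intro Sp_mult transv_Sp)
    show "Z 1 0 = qmat_id n" by (simp add: Z_def)
    have "mpoly (1 + (1 + 1)) (Z 1)" "mpoly (1 + (1 + 1)) (\<lambda>s. Z s 1)"
      unfolding Z_def by (intro mpoly_mult mpoly_transv)+
    then show "mpoly 3 (Z 1)" "mpoly 3 (\<lambda>s. Z s 1)" by (simp_all add: eval_nat_numeral)
    show "Z s 1 = scale_qmat (s^3) (Z 1 (1/s))" if "s \<noteq> 0" for s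
      using that by (simp add: Z_def transv_scale qmat_mult_scale_left qmat_mult_scale_right power3_eq_cube)
    show "qmat_mult n (Z 0 1) y = rank1 n v c u" using eq by (simp add: Z_def)
  qed
qed

text \<open>Along the homogenised curves the defect is a polynomial H with H 0 = -32. It is thus
  nonzero at some s other than 0, and t0 = 1/s works.\<close>

lemma ex_curve_rev_defect:
  assumes n: "n \<ge> 1" and y: "y1 \<in> Sp n" "y2 \<in> Sp n"
  obtains X1 X2 t0 where "\<And>t. X1 t \<in> Sp n" "\<And>t. X2 t \<in> Sp n" "X1 0 = qmat_id n" "X2 0 = qmat_id n"
    "mpoly 3 X1" "mpoly 3 X2" "rev_defect n (qmat_mult n (X1 t0) y1) (qmat_mult n (X2 t0) y2) \<noteq> 0"
proof -
  have [simp]: "qone \<noteq> 0" by (simp add: qone_def quat_eq_iff)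
  have nz: "vec_a n 1 \<noteq> 0 \<or> vec_a n (n+1) \<noteq> 0" "vec_b n 1 \<noteq> 0 \<or> vec_b n (n+1) \<noteq> 0"
    "covec_a n (n+1) \<noteq> 0" "covec_b n (n+1) \<noteq> 0"
    using n by (simp_all add: pair_vec_def)
  obtain X1 Y1 where 1: "\<And>t. X1 t \<in> Sp n" "X1 0 = qmat_id n" "mpoly 3 X1" "mpoly 3 Y1"
    "\<And>s. s \<noteq> 0 \<Longrightarrow> Y1 s = scale_qmat (s^3) (X1 (1/s))"
    "qmat_mult n (Y1 0) y1 = rank1 n (vec_a n) coef_ab (covec_a n)"
    by (rule escape_curve[where c = coef_ab, OF n y(1) pair_vec_isotropic(1)[OF n] nz(1) pair_vec_isotropic(2)[OF n] last_mem_ix(1) nz(3)]) blast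
  obtain X2 Y2 where 2: "\<And>t. X2 t \<in> Sp n" "X2 0 = qmat_id n" "mpoly 3 X2" "mpoly 3 Y2"
    "\<And>s. s \<noteq> 0 \<Longrightarrow> Y2 s = scale_qmat (s^3) (X2 (1/s))"
    "qmat_mult n (Y2 0) y2 = rank1 n (vec_b n) coef_ab (covec_b n)"
    by (rule escape_curve[where c = coef_ab, OF n y(2) pair_vec_isotropic(3)[OF n] nz(2) pair_vec_isotropic(4)[OF n] last_mem_ix(1) nz(4)]) blast
  define H where "H s = rev_defect n (qmat_mult n (Y1 s) y1) (qmat_mult n (Y2 s) y2)" for s
  \<comment> \<open>Degree 3 from the curve and 0 from the fixed matrix, times the word length
    8.\<close>
  have "rpoly ((3 + 0) * 8) H"
    unfolding H_def using 1 2 by (intro rpoly_rev_defect mpoly_mult mpoly_const)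
  moreover have "H 0 \<noteq> 0" using rev_defect_rank1[OF n] 1 2 by (simp add: H_def)
  ultimately have "finite {s. H s = 0}" by (rule rpoly_zeros)
  \<comment> \<open>The value 0 is excluded because Y s is a multiple of a group element only for
    nonzero s.\<close>
  then have "\<exists>s. s \<notin> insert 0 {s. H s = 0}"
    by (intro ex_new_if_finite infinite_UNIV_char_0) simp
  then obtain s where s: "s \<noteq> 0" "H s \<noteq> 0" by auto
  have "H s = (s^3)^4 * (s^3)^4 * rev_defect n (qmat_mult n (X1 (1/s)) y1) (qmat_mult n (X2 (1/s)) y2)"
    unfolding H_def 1(5)[OF s(1)] 2(5)[OF s(1)] by (simp only: qmat_mult_scale_left rev_defect_scale)
  with s(2) have "rev_defect n (qmat_mult n (X1 (1/s)) y1) (qmat_mult n (X2 (1/s)) y2) \<noteq> 0" by auto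
  with 1 2 show thesis using that by blast
qed

section \<open>Topology of the matrix groups\<close>

lemma pcls_eq_iff: "pcls A = pcls B \<longleftrightarrow> A = B \<or> A = - B"
  by (auto simp: pcls_def doubleton_eq_iff simp del: fun_Compl_def)

lemma carrier_PSp: "carrier (PSp n) = pcls ` Sp n"
  by (simp add: PSp_def PSp_carrier_def)

lemma PSp_mult: "pcls A \<otimes>\<^bsub>PSp n\<^esub> pcls B = pcls (qmat_mult n A B)"
proof -
  have "{qmat_mult n A' B' | A' B'. A' \<in> {A, - A} \<and> B' \<in> {B, - B}}
      = {qmat_mult n A B, qmat_mult n (- A) B, qmat_mult n A (- B), qmat_mult n (- A) (- B)}"
    by blast
  then show ?thesis
    by (auto simp: PSp_def pcls_def qmat_mult_minus_left qmat_mult_minus_right)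
qed

text \<open>\<open>m_inv\<close> is a definite description, so uniqueness is checked by hand: A B
  equal to I or -I forces B to be the adjoint of A or its negative.\<close>

lemma PSp_inv:
  assumes n: "n \<ge> 1" and A: "A \<in> Sp n"
  shows "inv\<^bsub>PSp n\<^esub> (pcls A) = pcls (qadj n A)"
  unfolding m_inv_def
proof (rule the_equality)
  show "pcls (qadj n A) \<in> carrier (PSp n) \<and> pcls A \<otimes>\<^bsub>PSp n\<^esub> pcls (qadj n A) = \<one>\<^bsub>PSp n\<^esub>
      \<and> pcls (qadj n A) \<otimes>\<^bsub>PSp n\<^esub> pcls A = \<one>\<^bsub>PSp n\<^esub>"
    using assms by (simp add: carrier_PSp PSp_mult Sp_adj Sp_adj_left Sp_adj_right) (simp add: PSp_def)
next
  fix y assume y: "y \<in> carrier (PSp n) \<and> pcls A \<otimes>\<^bsub>PSp n\<^esub> y = \<one>\<^bsub>PSp n\<^esub> \<and> y \<otimes>\<^bsub>PSp n\<^esub> pcls A = \<one>\<^bsub>PSp n\<^esub>"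
  then obtain B where B: "B \<in> Sp n" "y = pcls B" by (auto simp: carrier_PSp)
  with y have "pcls (qmat_mult n A B) = \<one>\<^bsub>PSp n\<^esub>" by (simp add: PSp_mult)
  then have "pcls (qmat_mult n A B) = pcls (qmat_id n)" by (simp add: PSp_def)
  then have "qmat_mult n A B = qmat_id n \<or> qmat_mult n A B = - qmat_id n"
    by (simp add: pcls_eq_iff)
  moreover have "B = qmat_mult n (qadj n A) (qmat_mult n A B)"
    using n A B by (simp add: Sp_adj_left Sp_supported flip: qmat_mult_assoc)
  ultimately have "B = qadj n A \<or> B = - qadj n A"
    by (auto simp: qmat_mult_minus_right)
  then show "y = pcls (qadj n A)" using B by (simp add: pcls_eq_iff)
qed

text \<open>Each conjugation relation between classes lifts to matrices up to a sign, which is the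
  form that \<open>rev_defect_eq_0\<close> accepts.\<close>

lemma strongly_doubly_reversible_imp_rev_defect:
  assumes n: "n \<ge> 1" and a: "a \<in> Sp n" and b: "b \<in> Sp n"
    and sdr: "strongly_doubly_reversible (PSp n) (pcls a) (pcls b)"
  shows "rev_defect n a b = 0"
proof -
  obtain g where g: "g \<in> Sp n"
    and ga: "pcls (qmat_mult n g (qmat_mult n a (qadj n g))) = pcls (qadj n a)"
    and gb: "pcls (qmat_mult n g (qmat_mult n b (qadj n g))) = pcls (qadj n b)"
    using sdr n a b unfolding strongly_doubly_reversible_def
    by (auto simp: carrier_PSp PSp_mult PSp_inv qmat_mult_assoc)
  have sign: "\<exists>s. (s = 1 \<or> s = - 1) \<and> A = scale_qmat s B" if "pcls A = pcls B" for A B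
    using that unfolding pcls_eq_iff
  proof
    assume "A = B"
    then show ?thesis by (intro exI[of _ 1]) simp
  next
    assume "A = - B"
    then show ?thesis by (intro exI[of _ "-1"]) (simp add: uminus_eq_scale_qmat)
  qed
  from sign[OF ga] sign[OF gb] show ?thesis using rev_defect_eq_0[OF n g a b] by blast
qed

section \<open>Continuity of the matrix operations, closedness and compactness\<close>

lemma continuous_on_uminus_qmat: "continuous_on UNIV (\<lambda>A :: qmat. - A)"
proof (intro continuous_on_coordinatewise_then_product)
  fix i j
  show "continuous_on UNIV (\<lambda>A :: qmat. (- A) i j)"
    unfolding uminus_qmat_nth
    by (intro continuous_intros continuous_on_compose2[OF continuous_on_product_coordinates continuous_on_product_coordinates]) auto
qed

lemma continuous_on_entry: "continuous_on S (\<lambda>A :: qmat. A i j)"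
  by (rule continuous_on_subset[OF continuous_on_compose2[OF continuous_on_product_coordinates
        continuous_on_product_coordinates]]) auto

definition cont_mat :: "'a::topological_space set \<Rightarrow> ('a \<Rightarrow> qmat) \<Rightarrow> bool" where
  "cont_mat S F \<longleftrightarrow> (\<forall>i j. continuous_on S (\<lambda>x. F x i j))"

text \<open>Matrices carry a twofold product topology; this reduces continuity to single entries in
  one step.\<close>

lemma cont_mat_iff: "cont_mat S F \<longleftrightarrow> continuous_on S F"
proof
  assume "cont_mat S F"
  then show "continuous_on S F"
    unfolding cont_mat_def by (intro continuous_on_coordinatewise_then_product) auto
next
  assume "continuous_on S F"
  then show "cont_mat S F"
    unfolding cont_mat_def by (auto intro: continuous_on_compose2[OF continuous_on_entry[of UNIV]])
qed

lemma continuous_on_qmat_mult: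
  assumes "continuous_on S F" "continuous_on S G"
  shows "continuous_on S (\<lambda>x. qmat_mult n (F x) (G x))"
  unfolding cont_mat_iff[symmetric] cont_mat_def
proof (intro allI)
  fix i j
  have "continuous_on S (\<lambda>x. F x i j)" "continuous_on S (\<lambda>x. G x i j)" for i j
    using assms unfolding cont_mat_iff[symmetric] cont_mat_def by auto
  then show "continuous_on S (\<lambda>x. qmat_mult n (F x) (G x) i j)"
    by (cases "i \<in> {1..n+1} \<and> j \<in> {1..n+1}")
      (auto simp: qmat_mult_def simp del: sum.cl_ivl_Suc intro!: continuous_intros qmul.continuous_on)
qed

lemma continuous_on_qadj:
  assumes "continuous_on S F"
  shows "continuous_on S (\<lambda>x. qadj n (F x))"
  unfolding cont_mat_iff[symmetric] cont_mat_def
proof (intro allI)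
  fix i j
  have "continuous_on S (\<lambda>x. F x i j)" for i j
    using assms unfolding cont_mat_iff[symmetric] cont_mat_def by auto
  then show "continuous_on S (\<lambda>x. qadj n (F x) i j)"
    by (cases "i \<in> ix n \<and> j \<in> ix n")
      (auto simp: qadj_def intro: bounded_linear.continuous_on[OF linear_qconj[unfolded linear_conv_bounded_linear]])
qed

lemma continuous_on_word:
  assumes "continuous_on S F" "continuous_on S G"
  shows "continuous_on S (\<lambda>x. word n (F x) (G x) w)"
proof (induction w)
  case (Cons y w)
  with assms show ?case by (cases y) (simp_all add: continuous_on_qmat_mult)
qed simp

lemma continuous_on_retr:
  assumes "continuous_on S F"
  shows "continuous_on S (\<lambda>x. retr n (F x))"
  using assms unfolding cont_mat_iff[symmetric] cont_mat_def retr_def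
  by (auto intro!: continuous_intros)

lemma continuous_on_rev_defect:
  assumes "continuous_on S F" "continuous_on S G"
  shows "continuous_on S (\<lambda>x. rev_defect n (F x) (G x))"
  unfolding rev_defect_def
  by (intro continuous_on_diff continuous_on_retr continuous_on_word assms)

lemma mpoly_continuous: "mpoly d X \<Longrightarrow> continuous_on S X"
proof -
  assume X: "mpoly d X"
  have "continuous_on S (\<lambda>t. X t i j)" for i j
  proof -
    have "continuous_on S (\<lambda>t. X t i j $ k)" for k
    proof -
      from X obtain p where "\<And>t. X t i j $ k = poly p t" unfolding mpoly_def rpoly_def by metis
      then show ?thesis by (simp add: continuous_intros)
    qed
    then have "continuous_on S (\<lambda>t. \<chi> k. X t i j $ k)" by (intro continuous_on_vec_lambda)
    then show ?thesis by simp
  qed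
  then show "continuous_on S X" unfolding cont_mat_iff[symmetric] cont_mat_def by blast
qed

lemma closed_Sp:
  assumes "n \<ge> 1" shows "closed (Sp n)"
proof -
  have "Sp n = {A. \<forall>i j. \<not> (i \<in> ix n \<and> j \<in> ix n) \<longrightarrow> A i j = 0} \<inter> {A. qmat_mult n (qadj n A) A = qmat_id n}"
    using Sp_iff[OF assms] unfolding supported_def by blast
  moreover have "closed {A :: qmat. \<forall>i j. \<not> (i \<in> ix n \<and> j \<in> ix n) \<longrightarrow> A i j = 0}"
    by (intro closed_Collect_all closed_Collect_imp open_Collect_const closed_Collect_eq 
        continuous_on_entry continuous_on_const)
  moreover have "closed {A. qmat_mult n (qadj n A) A = qmat_id n}"
    by (intro closed_Collect_eq continuous_on_qmat_mult continuous_on_qadj continuous_on_id continuous_on_const)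
  ultimately show ?thesis by auto
qed

text \<open>Tychonoff's theorem for a constant family of compact sets.\<close>

lemma compact_fun_Collect:
  fixes S :: "'b::topological_space set"
  assumes "compact S" shows "compact {f :: 'a \<Rightarrow> 'b. \<forall>i. f i \<in> S}"
proof -
  have "compactin (product_topology (\<lambda>i :: 'a. euclidean :: 'b topology) UNIV) (PiE UNIV (\<lambda>i. S))"
    using assms by (simp add: compactin_PiE)
  moreover have "PiE UNIV (\<lambda>i :: 'a. S) = {f. \<forall>i. f i \<in> S}" by (auto simp: PiE_def)
  ultimately show ?thesis by (simp add: euclidean_product_topology)
qed

text \<open>For growing K these sets form a compact exhaustion of \<open>Sp n\<close>.\<close>

definition Sp_bounded :: "nat \<Rightarrow> real \<Rightarrow> qmat set" where
  "Sp_bounded n K = {A \<in> Sp n. \<forall>i j. norm (A i j) \<le> K}"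

lemma compact_Sp_bounded:
  assumes "n \<ge> 1" shows "compact (Sp_bounded n K)"
proof -
  have "compact {A :: qmat. \<forall>i. A i \<in> {f. \<forall>j. f j \<in> cball 0 K}}"
    by (intro compact_fun_Collect compact_cball)
  moreover have "Sp_bounded n K = {A :: qmat. \<forall>i. A i \<in> {f. \<forall>j. f j \<in> cball 0 K}} \<inter> Sp n"
    by (auto simp: Sp_bounded_def)
  ultimately show ?thesis using closed_Sp[OF assms] by (simp add: compact_Int_closed)
qed

lemma supported_bounded: "supported n A \<Longrightarrow> \<exists>K. \<forall>i j. norm (A i j) < K"
proof -
  assume A: "supported n A"
  \<comment> \<open>The added 1 makes the bound strict, also at the zero entries outside the index
    range.\<close>
  define K where "K = (\<Sum>i\<in>ix n. \<Sum>j\<in>ix n. norm (A i j)) + 1"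
  have "norm (A i j) < K" for i j
  proof (cases "i \<in> ix n \<and> j \<in> ix n")
    case True
    have "norm (A i j) \<le> (\<Sum>j\<in>ix n. norm (A i j))"
      by (rule member_le_sum) (use True in auto)
    also have "\<dots> \<le> (\<Sum>i\<in>ix n. \<Sum>j\<in>ix n. norm (A i j))"
      by (rule member_le_sum) (use True in \<open>auto intro: sum_nonneg\<close>)
    finally show ?thesis by (simp add: K_def)
  next
    case False
    then have "A i j = 0" using A unfolding supported_def by blast
    moreover have "K > 0" unfolding K_def by (intro add_nonneg_pos sum_nonneg) auto
    ultimately show ?thesis by simp
  qed
  then show ?thesis by blast
qed

section \<open>Haar measure and the projective group\<close>

text \<open>Double counting: m translates have total measure m \<mu>(E), but they lie in W and cover
  each point at most D times, so m \<mu>(E) is at most D \<mu>(W) for every m. Measurability is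
  asked of the supersets A j instead of the translates.\<close>

lemma translates_null:
  fixes A :: "nat \<Rightarrow> 'a set"
  assumes haar: "is_haar_measure T mul \<mu>"
    and E: "E \<in> sets \<mu>" and W: "W \<in> sets \<mu>" "emeasure \<mu> W < \<infinity>"
    and h: "\<And>j. h j \<in> topspace T"
    and A: "\<And>j. A j \<in> sets \<mu>" "\<And>j. A j \<subseteq> W" "\<And>j. mul (h j) ` E \<subseteq> A j"
    and few: "\<And>w. w \<in> W \<Longrightarrow> finite {j. w \<in> A j}" "\<And>w. w \<in> W \<Longrightarrow> card {j. w \<in> A j} \<le> D"
  shows "emeasure \<mu> E = 0"
proof -
  have inv: "\<forall>g \<in> topspace T. \<forall>A \<in> sets \<mu>. emeasure \<mu> (mul g ` A) = emeasure \<mu> A"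
    using haar unfolding is_haar_measure_def by (elim conjE)
  have le: "emeasure \<mu> E \<le> emeasure \<mu> (A j)" for j
  proof -
    have "emeasure \<mu> E = emeasure \<mu> (mul (h j) ` E)"
      using inv h E by simp
    also have "\<dots> \<le> emeasure \<mu> (A j)" using A by (intro emeasure_mono) auto
    finally show ?thesis .
  qed
  have bound: "of_nat m * emeasure \<mu> E \<le> of_nat D * emeasure \<mu> W" for m
  proof -
    have "of_nat m * emeasure \<mu> E = (\<Sum>j<m. emeasure \<mu> E)" by simp
    also have "\<dots> \<le> (\<Sum>j<m. emeasure \<mu> (A j))" by (intro sum_mono le)
    also have "\<dots> = (\<integral>\<^sup>+w. (\<Sum>j<m. indicator (A j) w) \<partial>\<mu>)"
      using A by (subst nn_integral_sum) (auto simp: nn_integral_indicator)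
    also have "\<dots> \<le> (\<integral>\<^sup>+w. of_nat D * indicator W w \<partial>\<mu>)"
    proof (rule nn_integral_mono)
      fix w
      show "(\<Sum>j<m. indicator (A j) w :: ennreal) \<le> of_nat D * indicator W w"
      proof (cases "w \<in> W")
        case True
        \<comment> \<open>The sum of the indicators counts the sets that contain w.\<close>
        have "(\<Sum>j<m. indicator (A j) w :: ennreal) = of_nat (card {j \<in> {..<m}. w \<in> A j})"
          by (simp add: indicator_def sum.If_cases Int_def)
        also have "card {j \<in> {..<m}. w \<in> A j} \<le> card {j. w \<in> A j}"
          using few(1)[OF True] by (intro card_mono) auto
        also have "\<dots> \<le> D" by (rule few(2)[OF True])
        finally show ?thesis using True by simp
      next
        case False
        then have "w \<notin> A j" for j using A(2) by blast
        then show ?thesis by simp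
      qed
    qed
    also have "\<dots> = of_nat D * emeasure \<mu> W"
      using W by (simp add: nn_integral_cmult)
    finally show ?thesis .
  qed
  have fin: "of_nat D * emeasure \<mu> W < \<infinity>" using W(2) by (simp add: ennreal_mult_less_top of_nat_less_top)
  \<comment> \<open>Both measures are finite, so the bound becomes a statement about reals and the
    Archimedean property gives the conclusion.\<close>
  obtain C where C: "of_nat D * emeasure \<mu> W = ennreal C" "C \<ge> 0"
    using fin by (cases "of_nat D * emeasure \<mu> W") auto
  have "emeasure \<mu> E < \<infinity>" using bound[of 1] fin by (simp add: order.strict_trans1)
  then obtain e where e: "emeasure \<mu> E = ennreal e" "e \<ge> 0"
    by (cases "emeasure \<mu> E") auto
  have "real m * e \<le> C" for m
    using bound[of m] C e by (simp add: ennreal_of_nat_eq_real_of_nat flip: ennreal_mult)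
  then have "\<not> 0 < e" using reals_Archimedean3[of e] not_le by blast
  then show ?thesis using e by simp
qed

section \<open>The quotient topology on the projective group and on its square\<close>

lemma openin_PSp_top:
  "openin (PSp_top n) U \<longleftrightarrow> U \<subseteq> PSp_carrier n \<and> openin (Sp_top n) {A \<in> Sp n. pcls A \<in> U}"
proof -
  let ?P = "\<lambda>U. U \<subseteq> PSp_carrier n \<and> openin (Sp_top n) {A \<in> Sp n. pcls A \<in> U}"
  \<comment> \<open>Preimages commute with intersections and unions, so the predicate is a topology
    and the abstraction \<open>topology\<close> returns it.\<close>
  have "istopology ?P"
    unfolding istopology_def
  proof (intro conjI allI impI)
    fix S T assume "?P S" "?P T"
    moreover have "{A \<in> Sp n. pcls A \<in> S \<inter> T} = {A \<in> Sp n. pcls A \<in> S} \<inter> {A \<in> Sp n. pcls A \<in> T}" by auto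
    ultimately show "S \<inter> T \<subseteq> PSp_carrier n" "openin (Sp_top n) {A \<in> Sp n. pcls A \<in> S \<inter> T}"
      by auto
  next
    fix \<K> assume "\<forall>K\<in>\<K>. ?P K"
    moreover have "{A \<in> Sp n. pcls A \<in> \<Union>\<K>} = (\<Union>K\<in>\<K>. {A \<in> Sp n. pcls A \<in> K})" by auto
    ultimately show "\<Union>\<K> \<subseteq> PSp_carrier n" "openin (Sp_top n) {A \<in> Sp n. pcls A \<in> \<Union>\<K>}"
      by auto
  qed
  then show ?thesis unfolding PSp_top_def by (simp add: topology_inverse')
qed

lemma topspace_Sp_top [simp]: "topspace (Sp_top n) = Sp n"
  by (simp add: Sp_top_def)

lemma topspace_PSp_top [simp]: "topspace (PSp_top n) = PSp_carrier n"
proof -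
  have "{A \<in> Sp n. pcls A \<in> PSp_carrier n} = topspace (Sp_top n)" by (auto simp: PSp_carrier_def)
  then have "openin (PSp_top n) (PSp_carrier n)"
    unfolding openin_PSp_top by (simp only: openin_topspace order_refl simp_thms)
  moreover have "topspace (PSp_top n) \<subseteq> PSp_carrier n"
    using openin_PSp_top openin_topspace by blast
  ultimately show ?thesis using openin_subset by (intro subset_antisym)
qed

lemma continuous_map_pcls: "continuous_map (Sp_top n) (PSp_top n) pcls"
  by (auto simp: continuous_map_def PSp_carrier_def openin_PSp_top)

text \<open>The quotient map is open: the preimage of the image of V is the part of V and -V in
  \<open>Sp n\<close>, and negation is continuous.\<close>

lemma openin_pcls_image:
  assumes n: "n \<ge> 1" and V: "open V"
  shows "openin (PSp_top n) (pcls ` (V \<inter> Sp n))"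
  unfolding openin_PSp_top
proof
  have "{A \<in> Sp n. pcls A \<in> pcls ` (V \<inter> Sp n)} = Sp n \<inter> (V \<union> (\<lambda>A. - A) -` V)"
  proof (intro equalityI subsetI)
    fix A assume "A \<in> {A \<in> Sp n. pcls A \<in> pcls ` (V \<inter> Sp n)}"
    then obtain B where "A \<in> Sp n" "B \<in> V" "pcls A = pcls B" by auto
    then show "A \<in> Sp n \<inter> (V \<union> (\<lambda>A. - A) -` V)" by (auto simp: pcls_eq_iff)
  next
    fix A assume A: "A \<in> Sp n \<inter> (V \<union> (\<lambda>A. - A) -` V)"
    then have "A \<in> V \<inter> Sp n \<or> - A \<in> V \<inter> Sp n" using Sp_minus[OF n, of A] by auto
    moreover have "pcls A = pcls (- A)" by (simp add: pcls_eq_iff)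
    ultimately have "pcls A \<in> pcls ` (V \<inter> Sp n)" by blast
    with A show "A \<in> {A \<in> Sp n. pcls A \<in> pcls ` (V \<inter> Sp n)}" by simp
  qed
  moreover have "open (V \<union> (\<lambda>A. - A) -` V)"
    by (intro open_Un open_vimage V continuous_on_uminus_qmat)
  ultimately show "openin (Sp_top n) {A \<in> Sp n. pcls A \<in> pcls ` (V \<inter> Sp n)}"
    by (simp add: Sp_top_def openin_open_Int)
qed (auto simp: PSp_carrier_def)

definition pcls2 :: "qmat \<times> qmat \<Rightarrow> qmat set \<times> qmat set" where
  "pcls2 p = (pcls (fst p), pcls (snd p))"

lemma topspace_PSp2_top: "topspace (PSp2_top n) = pcls2 ` (Sp n \<times> Sp n)"
proof (intro equalityI subsetI)
  fix x assume "x \<in> topspace (PSp2_top n)"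
  then obtain a b where "x = pcls2 (a, b)" "(a, b) \<in> Sp n \<times> Sp n"
    by (auto simp: PSp2_top_def PSp_carrier_def pcls2_def)
  then show "x \<in> pcls2 ` (Sp n \<times> Sp n)" by (rule image_eqI)
qed (auto simp: PSp2_top_def PSp_carrier_def pcls2_def)

lemma PSp2_mult_pcls2:
  "PSp2_mult n (pcls2 p) (pcls2 q) = pcls2 (qmat_mult n (fst p) (fst q), qmat_mult n (snd p) (snd q))"
  by (simp add: PSp2_mult_def pcls2_def PSp_mult)

lemma openin_pcls2_image:
  assumes n: "n \<ge> 1" and V: "open V"
  shows "openin (PSp2_top n) (pcls2 ` (V \<inter> Sp n \<times> Sp n))"
  unfolding PSp2_top_def openin_prod_topology_alt
proof (intro allI impI)
  fix x y assume "(x, y) \<in> pcls2 ` (V \<inter> Sp n \<times> Sp n)"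
  then obtain a b where ab: "(a, b) \<in> V" "a \<in> Sp n" "b \<in> Sp n" "x = pcls a" "y = pcls b"
    by (auto simp: pcls2_def)
  obtain V1 V2 where V12: "open V1" "open V2" "a \<in> V1" "b \<in> V2" "V1 \<times> V2 \<subseteq> V"
    by (rule open_prod_elim[OF V ab(1)]) auto
  have "pcls ` (V1 \<inter> Sp n) \<times> pcls ` (V2 \<inter> Sp n) \<subseteq> pcls2 ` (V \<inter> Sp n \<times> Sp n)"
  proof
    fix z assume "z \<in> pcls ` (V1 \<inter> Sp n) \<times> pcls ` (V2 \<inter> Sp n)"
    then obtain c d where "z = pcls2 (c, d)" "c \<in> V1" "d \<in> V2" "c \<in> Sp n" "d \<in> Sp n"
      by (auto simp: pcls2_def)
    then show "z \<in> pcls2 ` (V \<inter> Sp n \<times> Sp n)" using V12(5) by blast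
  qed
  then show "\<exists>U V'. openin (PSp_top n) U \<and> openin (PSp_top n) V' \<and> x \<in> U \<and> y \<in> V'
      \<and> U \<times> V' \<subseteq> pcls2 ` (V \<inter> Sp n \<times> Sp n)"
    using V12 ab
    by (intro exI[of _ "pcls ` (V1 \<inter> Sp n)"] exI[of _ "pcls ` (V2 \<inter> Sp n)"] conjI openin_pcls_image n) auto
qed

text \<open>For C saturated under sign changes, the image of the complement is the complement of the
  image; openness of the quotient map then applies.\<close>

lemma closedin_pcls2_image:
  assumes n: "n \<ge> 1" and C: "closed C"
    and inv: "\<And>p q. p \<in> Sp n \<times> Sp n \<Longrightarrow> q \<in> Sp n \<times> Sp n \<Longrightarrow> pcls2 p = pcls2 q \<Longrightarrow> p \<in> C \<Longrightarrow> q \<in> C"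
  shows "closedin (PSp2_top n) (pcls2 ` (C \<inter> Sp n \<times> Sp n))"
proof -
  have "topspace (PSp2_top n) - pcls2 ` (C \<inter> Sp n \<times> Sp n) = pcls2 ` (- C \<inter> Sp n \<times> Sp n)"
  proof (intro equalityI subsetI)
    fix x assume "x \<in> topspace (PSp2_top n) - pcls2 ` (C \<inter> Sp n \<times> Sp n)"
    then show "x \<in> pcls2 ` (- C \<inter> Sp n \<times> Sp n)" unfolding topspace_PSp2_top by blast
  next
    fix x assume "x \<in> pcls2 ` (- C \<inter> Sp n \<times> Sp n)"
    then obtain p where p: "x = pcls2 p" "p \<notin> C" "p \<in> Sp n \<times> Sp n" by blast
    have "x \<notin> pcls2 ` (C \<inter> Sp n \<times> Sp n)"
    proof
      assume "x \<in> pcls2 ` (C \<inter> Sp n \<times> Sp n)"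
      then obtain q where "pcls2 q = pcls2 p" "q \<in> C" "q \<in> Sp n \<times> Sp n" using p(1) by auto
      with inv[of q p] p show False by simp
    qed
    then show "x \<in> topspace (PSp2_top n) - pcls2 ` (C \<inter> Sp n \<times> Sp n)"
      using p unfolding topspace_PSp2_top by blast
  qed
  then show ?thesis
    using openin_pcls2_image[OF n, of "- C"] C unfolding closedin_def
    by (simp add: open_Compl) (auto simp: topspace_PSp2_top)
qed

lemma compactin_pcls2_image:
  assumes "compact C" "C \<subseteq> Sp n \<times> Sp n"
  shows "compactin (PSp2_top n) (pcls2 ` C)"
proof (rule image_compactin)
  show "compactin (prod_topology (Sp_top n) (Sp_top n)) C"
    using assms by (simp add: Sp_top_def compactin_subtopology)
  show "continuous_map (prod_topology (Sp_top n) (Sp_top n)) (PSp2_top n) pcls2"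
    unfolding PSp2_top_def pcls2_def
    by (rule continuous_map_pairedI)
      (use continuous_map_compose[OF continuous_map_fst continuous_map_pcls]
           continuous_map_compose[OF continuous_map_snd continuous_map_pcls] in \<open>simp_all add: comp_def\<close>)
qed

section \<open>Borel sets of a Haar measure and sign invariance of the defect\<close>

lemma haar_sets_openin:
  assumes "is_haar_measure T mul \<mu>" "openin T U"
  shows "U \<in> sets \<mu>"
proof -
  have "{U. openin T U} \<subseteq> Pow (topspace T)" using openin_subset by blast
  then have "sets \<mu> = sigma_sets (topspace T) {U. openin T U}"
    using assms(1) by (simp add: is_haar_measure_def borel_of_top_def sets_measure_of)
  with assms(2) show ?thesis by (auto intro: sigma_sets.Basic)
qed

lemma haar_sets_closedin:
  assumes "is_haar_measure T mul \<mu>" "closedin T C"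
  shows "C \<in> sets \<mu>"
proof -
  have "topspace T - C \<in> sets \<mu>" using assms haar_sets_openin[OF assms(1)] by (simp add: closedin_def)
  moreover have "space \<mu> = topspace T" using assms(1) by (simp add: is_haar_measure_def)
  ultimately have "topspace T - (topspace T - C) \<in> sets \<mu>" by (metis sets.compl_sets)
  moreover have "C \<subseteq> topspace T" using assms(2) by (rule closedin_subset)
  ultimately show ?thesis by (simp add: double_diff)
qed

text \<open>A sign in a lift enters the defect as its fourth power. The factors x and y are included
  because translates of the zero set are projected as well.\<close>

lemma rev_defect_pcls2:
  assumes "pcls2 (a, b) = pcls2 (c, d)"
  shows "rev_defect n (qmat_mult n x a) (qmat_mult n y b) = rev_defect n (qmat_mult n x c) (qmat_mult n y d)"
proof -
  have sign: "\<exists>s::real. s^4 = 1 \<and> A = scale_qmat s B" if "pcls A = pcls B" for A B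
    using that unfolding pcls_eq_iff
  proof
    assume "A = B"
    then show ?thesis by (intro exI[of _ 1]) simp
  next
    assume "A = - B"
    then show ?thesis by (intro exI[of _ "-1"]) (simp add: uminus_eq_scale_qmat)
  qed
  have "pcls a = pcls c" "pcls b = pcls d" using assms by (simp_all add: pcls2_def)
  from sign[OF this(1)] sign[OF this(2)]
  obtain s t :: real where "s^4 = 1" "t^4 = 1" "a = scale_qmat s c" "b = scale_qmat t d"
    by (elim exE conjE)
  then show ?thesis by (simp add: qmat_mult_scale_right rev_defect_scale)
qed

section \<open>The zero set of the reversal defect is null\<close>

definition rev_null :: "nat \<Rightarrow> (qmat set \<times> qmat set) set" where
  "rev_null n = pcls2 ` ({p. rev_defect n (fst p) (snd p) = 0} \<inter> Sp n \<times> Sp n)"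

lemma closedin_translate_rev_null:
  assumes "n \<ge> 1"
  shows "closedin (PSp2_top n) (pcls2 ` ({p. rev_defect n (qmat_mult n x (fst p)) (qmat_mult n y (snd p)) = 0}
    \<inter> Sp n \<times> Sp n))"
proof (rule closedin_pcls2_image[OF assms])
  show "closed {p. rev_defect n (qmat_mult n x (fst p)) (qmat_mult n y (snd p)) = 0}"
    by (intro closed_Collect_eq continuous_on_rev_defect continuous_on_qmat_mult continuous_on_const
        continuous_on_fst continuous_on_snd continuous_on_id)
  fix p q assume "pcls2 p = pcls2 q" "p \<in> {p. rev_defect n (qmat_mult n x (fst p)) (qmat_mult n y (snd p)) = 0}"
  then show "q \<in> {p. rev_defect n (qmat_mult n x (fst p)) (qmat_mult n y (snd p)) = 0}"
    using rev_defect_pcls2[of "fst p" "snd p" "fst q" "snd q" n x y] by simp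
qed

text \<open>The zero set is its own translate by the identity, so closedness follows from the
  statement on translates.\<close>

lemma rev_null_eq:
  "rev_null n = pcls2 ` ({p. rev_defect n (qmat_mult n (qmat_id n) (fst p)) (qmat_mult n (qmat_id n) (snd p)) = 0}
    \<inter> Sp n \<times> Sp n)"
  unfolding rev_null_def by (intro arg_cong[of _ _ "image pcls2"]) (auto simp: Sp_supported)

lemma closedin_rev_null: "n \<ge> 1 \<Longrightarrow> closedin (PSp2_top n) (rev_null n)"
  unfolding rev_null_eq by (rule closedin_translate_rev_null)

lemma rev_null_iff:
  assumes "a \<in> Sp n" "b \<in> Sp n"
  shows "pcls2 (a, b) \<in> rev_null n \<longleftrightarrow> rev_defect n a b = 0"
proof
  assume "pcls2 (a, b) \<in> rev_null n"
  then obtain c d where cd: "pcls2 (a, b) = pcls2 (c, d)" "rev_defect n c d = 0" "c \<in> Sp n" "d \<in> Sp n"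
    unfolding rev_null_def by auto
  then show "rev_defect n a b = 0"
    using rev_defect_pcls2[OF cd(1), of n "qmat_id n" "qmat_id n"] assms by (simp add: Sp_supported)
next
  assume "rev_defect n a b = 0"
  then show "pcls2 (a, b) \<in> rev_null n" unfolding rev_null_def using assms by (intro image_eqI[OF refl]) auto
qed

lemma continuous_on_entry_fst: "continuous_on UNIV (\<lambda>p :: qmat \<times> 'a::topological_space. fst p i j)"
  by (rule continuous_on_compose2[OF continuous_on_entry[of UNIV] continuous_on_fst[OF continuous_on_id]]) simp

lemma continuous_on_entry_snd: "continuous_on UNIV (\<lambda>p :: 'a::topological_space \<times> qmat. snd p i j)"
  by (rule continuous_on_compose2[OF continuous_on_entry[of UNIV] continuous_on_snd[OF continuous_on_id]]) simp

lemma open_Collect_ball_finite: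
  "finite I \<Longrightarrow> (\<And>i. i \<in> I \<Longrightarrow> open {p. P i p}) \<Longrightarrow> open {p. \<forall>i\<in>I. P i p}"
  by (simp add: Collect_ball_eq open_INT)

lemma closedin_pcls2_bounded:
  assumes "n \<ge> 1"
  shows "closedin (PSp2_top n) (pcls2 ` (Sp_bounded n K \<times> Sp_bounded n K))"
proof -
  let ?C = "{p :: qmat \<times> qmat. (\<forall>i j. norm (fst p i j) \<le> K) \<and> (\<forall>i j. norm (snd p i j) \<le> K)}"
  have "Sp_bounded n K \<times> Sp_bounded n K = ?C \<inter> Sp n \<times> Sp n" by (auto simp: Sp_bounded_def)
  moreover have "closedin (PSp2_top n) (pcls2 ` (?C \<inter> Sp n \<times> Sp n))"
  proof (rule closedin_pcls2_image[OF assms])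
    show "closed ?C"
      by (intro closed_Collect_conj closed_Collect_all closed_Collect_le continuous_on_norm continuous_on_const
          continuous_on_entry_fst continuous_on_entry_snd)
    fix p q assume "pcls2 p = pcls2 q" and p: "p \<in> ?C"
    then have "fst q = fst p \<or> fst q = - fst p" "snd q = snd p \<or> snd q = - snd p"
      unfolding pcls2_def by (auto simp: pcls_eq_iff)
    then have "norm (fst q i j) = norm (fst p i j)" "norm (snd q i j) = norm (snd p i j)" for i j by auto
    with p show "q \<in> ?C" by simp
  qed
  ultimately show ?thesis by simp
qed

text \<open>On a bounded neighbourhood V the defect along the curve is nonzero at t0. A smaller
  neighbourhood V0 stays inside V when moved by the inverse of the curve at small parameters \<tau>
  j. Such a translate of the zeros E in V0 consists of zeros of f (\<tau> j), and a point of V is a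
  zero of at most 24 of these functions, so \<open>translates_null\<close> applies.\<close>

lemma rev_null_locally_null:
  assumes n: "n \<ge> 1" and haar: "is_haar_measure (PSp2_top n) (PSp2_mult n) \<mu>"
    and y: "y1 \<in> Sp n" "y2 \<in> Sp n"
  shows "\<exists>V. open V \<and> (y1, y2) \<in> V \<and> rev_null n \<inter> pcls2 ` (V \<inter> Sp n \<times> Sp n) \<in> sets \<mu>
     \<and> emeasure \<mu> (rev_null n \<inter> pcls2 ` (V \<inter> Sp n \<times> Sp n)) = 0"
proof -
  obtain X1 X2 t0 where X: "\<And>t. X1 t \<in> Sp n" "\<And>t. X2 t \<in> Sp n" "X1 0 = qmat_id n" "X2 0 = qmat_id n"
    "mpoly 3 X1" "mpoly 3 X2" "rev_defect n (qmat_mult n (X1 t0) y1) (qmat_mult n (X2 t0) y2) \<noteq> 0"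
    by (rule ex_curve_rev_defect[OF n y]) blast
  obtain K1 where K1: "\<forall>i j. norm (y1 i j) < K1"
    using supported_bounded[OF Sp_supported[OF y(1)]] ..
  obtain K2 where K2: "\<forall>i j. norm (y2 i j) < K2"
    using supported_bounded[OF Sp_supported[OF y(2)]] ..
  define K where "K = max K1 K2"
  define f where "f t p = rev_defect n (qmat_mult n (X1 t) (fst p)) (qmat_mult n (X2 t) (snd p))" for t p
  \<comment> \<open>The entry bounds range over the finite index set to keep V open; they give W
    finite measure. The condition at t0 keeps t \<mapsto> f t p from vanishing identically.\<close>
  define V where "V = {p. f t0 p \<noteq> 0} \<inter>
    {p. (\<forall>i\<in>ix n. \<forall>j\<in>ix n. norm (fst p i j) < K) \<and> (\<forall>i\<in>ix n. \<forall>j\<in>ix n. norm (snd p i j) < K)}"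
  have "open V"
    unfolding V_def
  proof (intro open_Int)
    show "open {p. f t0 p \<noteq> 0}" unfolding f_def
      by (intro open_Collect_neq continuous_on_rev_defect continuous_on_qmat_mult continuous_on_const
        continuous_on_fst continuous_on_snd continuous_on_id)
    show "open {p :: qmat \<times> qmat. (\<forall>i\<in>ix n. \<forall>j\<in>ix n. norm (fst p i j) < K) \<and> (\<forall>i\<in>ix n. \<forall>j\<in>ix n. norm (snd p i j) < K)}"
      by (intro open_Collect_conj open_Collect_ball_finite open_Collect_less continuous_on_norm continuous_on_const
          continuous_on_entry_fst continuous_on_entry_snd finite_ix)
  qed
  have K: "norm (y1 i j) < K" "norm (y2 i j) < K" for i j
    using K1[rule_format, of i j] K2[rule_format, of i j] by (simp_all add: K_def)
  have yV: "(y1, y2) \<in> V" using X(7) K by (simp add: V_def f_def)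
  \<comment> \<open>Translation by the inverse of the curve, jointly continuous in parameter and
    point and trivial at parameter 0, so a box I x V0 around (0, y) is mapped into V.\<close>
  define \<Psi> where "\<Psi> z = (qmat_mult n (qadj n (X1 (fst z))) (fst (snd z)), qmat_mult n (qadj n (X2 (fst z))) (snd (snd z)))"
    for z :: "real \<times> qmat \<times> qmat"
  have "continuous_on UNIV \<Psi>"
  proof -
    have "continuous_on UNIV (\<lambda>z :: real \<times> qmat \<times> qmat. X1 (fst z))" "continuous_on UNIV (\<lambda>z :: real \<times> qmat \<times> qmat. X2 (fst z))"
      by (rule continuous_on_compose2[OF mpoly_continuous[OF X(5), of UNIV] continuous_on_fst[OF continuous_on_id]]
          continuous_on_compose2[OF mpoly_continuous[OF X(6), of UNIV] continuous_on_fst[OF continuous_on_id]], simp)+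
    then show ?thesis
      unfolding \<Psi>_def
      by (intro continuous_on_Pair continuous_on_qmat_mult continuous_on_qadj continuous_on_fst continuous_on_snd continuous_on_id)
  qed
  then have "open (\<Psi> -` V)" using \<open>open V\<close> by (rule open_vimage[rotated])
  moreover have "(0, (y1, y2)) \<in> \<Psi> -` V" using yV y by (simp add: \<Psi>_def X Sp_supported)
  ultimately obtain I V0 where I: "open I" "open V0" "0 \<in> I" "(y1, y2) \<in> V0" "I \<times> V0 \<subseteq> \<Psi> -` V"
    by (rule open_prod_elim) auto
  obtain \<epsilon> where \<epsilon>: "\<epsilon> > 0" "\<And>t. dist t 0 < \<epsilon> \<Longrightarrow> t \<in> I"
    using I(1,3) unfolding open_dist by blast
  \<comment> \<open>Infinitely many distinct parameters; the 2 in the denominator makes even \<tau>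
    0 strictly smaller than \<epsilon>.\<close>
  define \<tau> where "\<tau> j = \<epsilon> / (real j + 2)" for j :: nat
  have \<tau>: "\<tau> j \<in> I" for j
    by (rule \<epsilon>(2)) (use \<epsilon>(1) in \<open>simp add: \<tau>_def divide_less_eq\<close>)
  have inj: "inj \<tau>" using \<epsilon>(1) by (auto simp: inj_def \<tau>_def)
  let ?S = "Sp n \<times> Sp n"
  define W where "W = pcls2 ` (V \<inter> ?S)"
  define A where "A j = W \<inter> pcls2 ` ({p. f (\<tau> j) p = 0} \<inter> ?S)" for j
  define E where "E = rev_null n \<inter> pcls2 ` (V0 \<inter> ?S)"
  have f_inv: "f t p = f t q" if "pcls2 p = pcls2 q" for t p q
    using rev_defect_pcls2[of "fst p" "snd p" "fst q" "snd q" n] that by (simp add: f_def)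
  have E: "E \<in> sets \<mu>" unfolding E_def
    by (intro sets.Int haar_sets_openin[OF haar] haar_sets_closedin[OF haar] closedin_rev_null openin_pcls2_image n I)
  have W: "W \<in> sets \<mu>" unfolding W_def
    by (intro haar_sets_openin[OF haar] openin_pcls2_image n \<open>open V\<close>)
  have Wfin: "emeasure \<mu> W < \<infinity>"
  proof -
    \<comment> \<open>W lies in the image of a compact set, which a Haar measure makes
      finite.\<close>
    let ?B = "pcls2 ` (Sp_bounded n K \<times> Sp_bounded n K)"
    have "V \<inter> ?S \<subseteq> Sp_bounded n K \<times> Sp_bounded n K"
    proof
      fix p assume p: "p \<in> V \<inter> ?S"
      \<comment> \<open>Positivity of K covers the entries outside the index range, which are
        0.\<close>
      have "K > 0" using K(1)[of 0 0] norm_ge_zero[of "y1 0 0"] by linarith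
      have "norm (B i j) \<le> K" if "B \<in> Sp n" "\<forall>i\<in>ix n. \<forall>j\<in>ix n. norm (B i j) < K" for B i j
        using that Sp_supported[OF that(1)] \<open>K > 0\<close> unfolding supported_def
        by (cases "i \<in> ix n \<and> j \<in> ix n") (auto intro: less_imp_le)
      note this[of "fst p"] this[of "snd p"]
      with p show "p \<in> Sp_bounded n K \<times> Sp_bounded n K"
        by (simp add: V_def Sp_bounded_def mem_Times_iff)
    qed
    then have "W \<subseteq> ?B" unfolding W_def by (rule image_mono)
    moreover have "?B \<in> sets \<mu>" by (intro haar_sets_closedin[OF haar] closedin_pcls2_bounded n)
    ultimately have "emeasure \<mu> W \<le> emeasure \<mu> ?B" by (rule emeasure_mono)
    moreover have "compactin (PSp2_top n) ?B"
      by (intro compactin_pcls2_image compact_Times compact_Sp_bounded n) (auto simp: Sp_bounded_def)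
    then have "emeasure \<mu> ?B < \<infinity>" using haar unfolding is_haar_measure_def by (elim conjE) blast
    ultimately show ?thesis by (rule order.strict_trans1)
  qed
  have "emeasure \<mu> E = 0"
  proof (rule translates_null[OF haar E W Wfin])
    fix j
    show "pcls2 (qadj n (X1 (\<tau> j)), qadj n (X2 (\<tau> j))) \<in> topspace (PSp2_top n)"
      unfolding topspace_PSp2_top using X(1,2) n by (intro imageI) (simp add: Sp_adj)
    show "A j \<in> sets \<mu>" unfolding A_def f_def
      by (intro sets.Int W haar_sets_closedin[OF haar] closedin_translate_rev_null n)
    show "A j \<subseteq> W" by (simp add: A_def)
    show "PSp2_mult n (pcls2 (qadj n (X1 (\<tau> j)), qadj n (X2 (\<tau> j)))) ` E \<subseteq> A j"
    proof
      fix z assume "z \<in> PSp2_mult n (pcls2 (qadj n (X1 (\<tau> j)), qadj n (X2 (\<tau> j)))) ` E"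
      then obtain a b where ab: "(a, b) \<in> V0" "a \<in> Sp n" "b \<in> Sp n" "pcls2 (a, b) \<in> rev_null n"
        "z = PSp2_mult n (pcls2 (qadj n (X1 (\<tau> j)), qadj n (X2 (\<tau> j)))) (pcls2 (a, b))"
        unfolding E_def by auto
      let ?p = "\<Psi> (\<tau> j, (a, b))"
      have z: "z = pcls2 ?p" by (simp add: ab(5) PSp2_mult_pcls2 \<Psi>_def)
      have S: "?p \<in> ?S" using ab n X(1,2) by (simp add: \<Psi>_def Sp_mult Sp_adj)
      have "(\<tau> j, (a, b)) \<in> I \<times> V0" using \<tau>[of j] ab(1) by simp
      then have V: "?p \<in> V" using I(5) by (auto simp only: vimage_def)
      \<comment> \<open>Applying the curve undoes the translation, so f (\<tau> j) at the moved
        point is the defect of (a, b), which is 0.\<close>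
      have "qmat_mult n (X1 (\<tau> j)) (qmat_mult n (qadj n (X1 (\<tau> j))) a) = a"
        "qmat_mult n (X2 (\<tau> j)) (qmat_mult n (qadj n (X2 (\<tau> j))) b) = b"
        using ab n X(1,2) by (simp_all add: Sp_adj_right Sp_supported flip: qmat_mult_assoc)
      then have "f (\<tau> j) ?p = 0" using ab rev_null_iff by (simp add: f_def \<Psi>_def)
      then show "z \<in> A j" unfolding A_def W_def z using S V by (intro IntI imageI CollectI)
    qed
  next
    fix w assume "w \<in> W"
    then obtain p where p: "w = pcls2 p" "p \<in> V" by (auto simp: W_def)
    have poly: "rpoly ((3 + 0) * 8) (\<lambda>t. f t p)"
      unfolding f_def by (intro rpoly_rev_defect mpoly_mult mpoly_const X)
    have nz: "f t0 p \<noteq> 0" using p(2) by (simp add: V_def)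
    \<comment> \<open>Membership in A j may be witnessed by another lift q of w; since f depends
      only on the class, p is a zero too.\<close>
    have sub: "\<tau> ` {j. w \<in> A j} \<subseteq> {t. f t p = 0}"
    proof
      fix t assume "t \<in> \<tau> ` {j. w \<in> A j}"
      then obtain j q where "t = \<tau> j" "w = pcls2 q" "f (\<tau> j) q = 0" by (auto simp: A_def)
      then show "t \<in> {t. f t p = 0}" using f_inv[of p q] p(1) by simp
    qed
    have fin: "finite (\<tau> ` {j. w \<in> A j})"
      using rpoly_zeros(1)[OF poly nz] sub by (rule finite_subset[rotated])
    then show "finite {j. w \<in> A j}" by (rule finite_imageD) (rule inj_on_subset[OF inj subset_UNIV])
    have "card {j. w \<in> A j} = card (\<tau> ` {j. w \<in> A j})"
      by (rule card_image[OF inj_on_subset[OF inj subset_UNIV], symmetric])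
    also have "\<dots> \<le> card {t. f t p = 0}" by (rule card_mono[OF rpoly_zeros(1)[OF poly nz] sub])
    also have "\<dots> \<le> 24" using rpoly_zeros(2)[OF poly nz] by simp
    finally show "card {j. w \<in> A j} \<le> 24" .
  qed
  with E have "E \<in> sets \<mu> \<and> emeasure \<mu> E = 0" by simp
  then show ?thesis unfolding E_def by (intro exI[of _ V0] conjI I) simp_all
qed

text \<open>Local nullness becomes global by sigma-compactness: each bounded piece B k is covered by
  finitely many null neighbourhoods, and countably many pieces exhaust the group.\<close>

lemma emeasure_rev_null:
  assumes n: "n \<ge> 1" and haar: "is_haar_measure (PSp2_top n) (PSp2_mult n) \<mu>"
  shows "emeasure \<mu> (rev_null n) = 0"
proof -
  let ?S = "Sp n \<times> Sp n"
  have "\<forall>p\<in>?S. \<exists>V. open V \<and> p \<in> V \<and> rev_null n \<inter> pcls2 ` (V \<inter> ?S) \<in> null_sets \<mu>"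
  proof
    fix p assume "p \<in> ?S"
    then have "fst p \<in> Sp n" "snd p \<in> Sp n" by auto
    from rev_null_locally_null[OF n haar this]
    show "\<exists>V. open V \<and> p \<in> V \<and> rev_null n \<inter> pcls2 ` (V \<inter> ?S) \<in> null_sets \<mu>"
      by (simp add: null_sets_def)
  qed
  from bchoice[OF this] obtain V where
    VV: "\<forall>p\<in>?S. open (V p) \<and> p \<in> V p \<and> rev_null n \<inter> pcls2 ` (V p \<inter> ?S) \<in> null_sets \<mu>" ..
  note V = VV[THEN bspec, THEN conjunct1] VV[THEN bspec, THEN conjunct2, THEN conjunct1]
    VV[THEN bspec, THEN conjunct2, THEN conjunct2]
  define B where "B k = Sp_bounded n (real k) \<times> Sp_bounded n (real k)" for k :: nat
  have B: "B k \<subseteq> ?S" for k by (auto simp: B_def Sp_bounded_def)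
  have null: "rev_null n \<inter> pcls2 ` B k \<in> null_sets \<mu>" for k
  proof -
    have "compact (B k)" unfolding B_def by (intro compact_Times compact_Sp_bounded n)
    moreover have "open (V p)" if "p \<in> B k" for p using V(1) B that by blast
    moreover have "B k \<subseteq> (\<Union>p\<in>B k. V p)" using V(2) B by blast
    ultimately obtain F where F: "F \<subseteq> B k" "finite F" "B k \<subseteq> (\<Union>p\<in>F. V p)"
      by (rule compactE_image)
    have "(\<Union>p\<in>F. rev_null n \<inter> pcls2 ` (V p \<inter> ?S)) \<in> null_sets \<mu>"
      by (rule null_sets.finite_UN[OF F(2)]) (rule V(3)[OF subsetD[OF B subsetD[OF F(1)]]])
    moreover have "rev_null n \<inter> pcls2 ` B k \<in> sets \<mu>"
      unfolding B_def
      by (intro sets.Int haar_sets_closedin[OF haar] closedin_rev_null closedin_pcls2_bounded n)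
    moreover have "rev_null n \<inter> pcls2 ` B k \<subseteq> (\<Union>p\<in>F. rev_null n \<inter> pcls2 ` (V p \<inter> ?S))"
    proof
      fix x assume "x \<in> rev_null n \<inter> pcls2 ` B k"
      then obtain q where q: "x = pcls2 q" "q \<in> B k" "x \<in> rev_null n" by blast
      then obtain p where "p \<in> F" "q \<in> V p" using F(3) by blast
      moreover have "q \<in> ?S" using q(2) B by (rule subsetD[rotated])
      ultimately show "x \<in> (\<Union>p\<in>F. rev_null n \<inter> pcls2 ` (V p \<inter> ?S))"
        using q(1,3) by (intro UN_I[of p] IntI) simp_all
    qed
    ultimately show ?thesis by (rule null_sets_subset)
  qed
  have "rev_null n = (\<Union>k. rev_null n \<inter> pcls2 ` B k)"
  proof -
    have "\<exists>k. p \<in> B k" if "p \<in> ?S" for p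
    proof -
      have p: "fst p \<in> Sp n" "snd p \<in> Sp n" using that by auto
      obtain K1 where K1: "\<forall>i j. norm (fst p i j) < K1"
        using supported_bounded[OF Sp_supported[OF p(1)]] ..
      obtain K2 where K2: "\<forall>i j. norm (snd p i j) < K2"
        using supported_bounded[OF Sp_supported[OF p(2)]] ..
      obtain k where k: "max K1 K2 \<le> real k" using real_arch_simple by blast
      have "norm (fst p i j) \<le> real k" "norm (snd p i j) \<le> real k" for i j
        using K1[rule_format, of i j] K2[rule_format, of i j] k by linarith+
      then show ?thesis using p by (intro exI[of _ k]) (simp add: B_def Sp_bounded_def mem_Times_iff)
    qed
    then have cover: "?S \<subseteq> (\<Union>k. B k)" by blast
    have "rev_null n \<subseteq> pcls2 ` ?S" unfolding rev_null_def by blast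
    also have "\<dots> \<subseteq> (\<Union>k. pcls2 ` B k)" using image_mono[OF cover] by (simp only: image_UN)
    finally show ?thesis by blast
  qed
  moreover have "(\<Union>k. rev_null n \<inter> pcls2 ` B k) \<in> null_sets \<mu>" using null by (rule null_sets_UN)
  ultimately show ?thesis using null_setsD1 by simp
qed

theorem theorem4p1:
  fixes n :: nat
  assumes "n \<ge> 1"
  shows "haar_null (PSp2_top n) (PSp2_mult n)
           {(g1, g2). g1 \<in> carrier (PSp n) \<and> g2 \<in> carrier (PSp n)
                      \<and> strongly_doubly_reversible (PSp n) g1 g2}"
  unfolding haar_null_def
proof (intro allI impI bexI conjI)
  fix \<mu> assume haar: "is_haar_measure (PSp2_top n) (PSp2_mult n) \<mu>"
  \<comment> \<open>The closed set \<open>rev_null n\<close> is the Borel null set that contains the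
    pairs in question.\<close>
  show "emeasure \<mu> (rev_null n) = 0" by (rule emeasure_rev_null[OF assms haar])
  show "rev_null n \<in> sets \<mu>" by (rule haar_sets_closedin[OF haar closedin_rev_null[OF assms]])
  show "{(g1, g2). g1 \<in> carrier (PSp n) \<and> g2 \<in> carrier (PSp n) 
      \<and> strongly_doubly_reversible (PSp n) g1 g2} \<subseteq> rev_null n"
  proof clarify
    fix g1 g2 assume g: "g1 \<in> carrier (PSp n)" "g2 \<in> carrier (PSp n)"
      "strongly_doubly_reversible (PSp n) g1 g2"
    then obtain a b where ab: "a \<in> Sp n" "b \<in> Sp n" "g1 = pcls a" "g2 = pcls b"
      by (auto simp: carrier_PSp)
    then have "rev_defect n a b = 0"
      using strongly_doubly_reversible_imp_rev_defect[OF assms] g(3) by blast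
    then show "(g1, g2) \<in> rev_null n" using rev_null_iff[OF ab(1,2)] ab by (simp add: pcls2_def)
  qed
qed

end
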